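(* Let $G$ be a connected Lie subgroup of $\mathrm{Conf}(\mathbb{E}\mathrm{in}^{1,2})$ which acts on $\mathbb{E}\mathrm{in}^{1,2}$ reducibly and with cohomogeneity one. Then $G$ fixes a point in the projective space $\mathbb{RP}^4=\mathbb{P}(\mathbb{R}^{2,3})$.
   Context: $\mathbb{R}^{2,3}$ is $\mathbb{R}^5$ with the quadratic form $\mathfrak{q}(v)=-v_1^2-v_2^2+v_3^2+v_4^2+v_5^2$. The 3-dimensional Einstein universe $\mathbb{E}\mathrm{in}^{1,2}\subset\mathbb{RP}^4$ is the projectivization of the nullcone $\{v\neq 0:\mathfrak{q}(v)=0\}$, with its induced Lorentzian conformal structure; $\mathrm{Conf}(\mathbb{E}\mathrm{in}^{1,2})=PO(2,3)$, whose identity component is $SO_\circ(2,3)$ (the identity component of $O(2,3)$), so a connected subgroup $G$ is regarded as a subgroup of $SO_\circ(2,3)$ acting linearly on $\mathbb{R}^{2,3}$. Lie subgroups are not assumed closed. The action of $G$ is irreducible if $G$ preserves no non-trivial proper linear subspace of $\mathbb{R}^{2,3}$, and reducible otherwise. The action of a Lie group on a manifold is of cohomogeneity one if it admits an orbit of codimension one (here: a 2-dimensional orbit in $\mathbb{E}\mathrm{in}^{1,2}$). *)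

theory Defs
  imports "HOL-Analysis.Analysis"
begin

text \<open>In the index type \<open>5\<close> the numeral \<open>5\<close> denotes \<open>0\<close>, so \<open>1, 2, 3, 4, 5\<close> are its five distinct
  elements.\<close>

definition qform :: "real^5 \<Rightarrow> real" where
  "qform v = - (v$1)\<^sup>2 - (v$2)\<^sup>2 + (v$3)\<^sup>2 + (v$4)\<^sup>2 + (v$5)\<^sup>2"

definition O23 :: "(real^5^5) set" where
  "O23 = {A. \<forall>v. qform (A *v v) = qform v}"

definition SO23_id_component :: "(real^5^5) set" where
  "SO23_id_component = connected_component_set O23 (mat 1)"

text \<open>Points of a projective space are lines through the origin; a matrix \<open>A\<close> acts on them by
  \<open>p \<mapsto> (\<lambda>v. A *v v) ` p\<close>.\<close>

definition projective_space :: "(real^'n) set set" where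
  "projective_space = {span {v} | v. v \<noteq> 0}"

definition Ein12 :: "(real^5) set set" where
  "Ein12 = {span {v} | v. v \<noteq> 0 \<and> qform v = 0}"

text \<open>The functions of class \<open>C\<^sup>k\<close> on a relatively open subset \<open>U\<close> of a linear space \<open>V\<close>: all iterated
  directional derivatives of order at most \<open>k\<close> along vectors of \<open>V\<close> exist and are continuous on \<open>U\<close>.
  Values of \<open>f\<close> outside \<open>U\<close> are irrelevant, because \<open>u + t *\<^sub>R v\<close> stays in \<open>U\<close> for small \<open>t\<close>.\<close>

primrec Ck_on ::
  "nat \<Rightarrow> 'a::euclidean_space set \<Rightarrow> 'a set \<Rightarrow> ('a \<Rightarrow> 'b::euclidean_space) \<Rightarrow> bool" where
  "Ck_on 0 V U f \<longleftrightarrow> continuous_on U f"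
| "Ck_on (Suc k) V U f \<longleftrightarrow> continuous_on U f \<and>
     (\<forall>v\<in>V. \<exists>f'. (\<forall>u\<in>U. ((\<lambda>t. f (u + t *\<^sub>R v)) has_vector_derivative f' u) (at 0)) \<and>
                  Ck_on k V U f')"

definition smooth_immersion_on ::
  "'a::euclidean_space set \<Rightarrow> 'a set \<Rightarrow> ('a \<Rightarrow> 'b::euclidean_space) \<Rightarrow> bool" where
  "smooth_immersion_on V U f \<longleftrightarrow> (\<forall>k. Ck_on k V U f) \<and>
     (\<forall>u\<in>U. \<forall>v\<in>V. v \<noteq> 0 \<longrightarrow> vector_derivative (\<lambda>t. f (u + t *\<^sub>R v)) (at 0) \<noteq> 0)"

text \<open>A Lie subgroup of the general linear group, not necessarily closed, is represented by its
  intrinsic topology \<open>G\<close>, in general finer than the subspace topology; its underlying set is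
  \<open>topspace G\<close>. It is a topological group and a manifold whose inclusion into the space of matrices
  is a smooth immersion. Two local parametrizations as below are automatically smoothly
  compatible and the group operations are automatically smooth in them, because a continuous map
  into \<open>G\<close> that is smooth as a matrix-valued map is smooth in every such parametrization.
  The model space \<open>V\<close> can be taken inside the space of matrices, since the dimension of an immersed
  submanifold does not exceed that of the ambient space.\<close>

definition lie_subgroup :: "(real^'n^'n) topology \<Rightarrow> bool" where
  "lie_subgroup G \<longleftrightarrow>
     (\<forall>A\<in>topspace G. invertible A) \<and>
     mat 1 \<in> topspace G \<and>
     continuous_map (prod_topology G G) G (\<lambda>(A, B). A ** B) \<and>
     continuous_map G G matrix_inv \<and>
     (\<exists>V :: (real^'n^'n) set. subspace V \<and>
        (\<forall>A\<in>topspace G. \<exists>U \<phi>. openin (top_of_set V) U \<and>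
           A \<in> \<phi> ` U \<and> openin G (\<phi> ` U) \<and>
           homeomorphic_map (top_of_set U) (subtopology G (\<phi> ` U)) \<phi> \<and>
           smooth_immersion_on V U \<phi>))"

definition matrix_exp :: "real^'n^'n \<Rightarrow> real^'n^'n" where
  "matrix_exp X = (\<Sum>n. (((\<lambda>B. X ** B) ^^ n) (mat 1)) /\<^sub>R fact n)"

text \<open>The generators of the one-parameter subgroups of \<open>G\<close>, continuous for its intrinsic topology.\<close>

definition lie_algebra :: "(real^'n^'n) topology \<Rightarrow> (real^'n^'n) set" where
  "lie_algebra G = {X. continuous_map euclideanreal G (\<lambda>t. matrix_exp (t *\<^sub>R X))}"

definition stabilizer :: "(real^'n^'n) topology \<Rightarrow> (real^'n) set \<Rightarrow> (real^'n^'n) topology" where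
  "stabilizer G p = subtopology G {A. (\<lambda>v. A *v v) ` p = p}"

text \<open>The orbit of \<open>p\<close> is the homogeneous manifold \<open>G / stabilizer G p\<close>, immersed in the projective
  space but not necessarily embedded; its dimension is that of \<open>G\<close> minus that of the stabilizer.\<close>

definition orbit_dim :: "(real^'n^'n) topology \<Rightarrow> (real^'n) set \<Rightarrow> nat" where
  "orbit_dim G p = dim (lie_algebra G) - dim (lie_algebra (stabilizer G p))"

definition cohomogeneity_one_on_Ein12 :: "(real^5^5) topology \<Rightarrow> bool" where
  "cohomogeneity_one_on_Ein12 G \<longleftrightarrow> (\<exists>p\<in>Ein12. orbit_dim G p = 2)"

definition acts_reducibly :: "(real^'n^'n) topology \<Rightarrow> bool" where
  "acts_reducibly G \<longleftrightarrow>
     (\<exists>W. subspace W \<and> W \<noteq> {0} \<and> W \<noteq> UNIV \<and> (\<forall>A\<in>topspace G. (\<lambda>v. A *v v) ` W = W))"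

end

theory Submission
  imports Defs
begin

text \<open>A fixed point of the projective space is an invariant line, and a connected Lie group has the same
  invariant subspaces as its Lie algebra. The theorem therefore reduces to a statement about a Lie
  algebra \<open>g\<close> of endomorphisms that are skew for the form: if \<open>g\<close> has a nonzero proper invariant subspace \<open>W\<close>
  and, for some null vector \<open>v\<close>, the space \<open>g v\<close> has dimension two modulo \<open>v\<close>, then \<open>g\<close> has an
  invariant line.

  The reduction needs just one fact about Lie groups, \<open>limit_in_lie_algebra\<close>, proved by von
  Neumann's argument: if elements \<open>A n\<close> of \<open>G\<close> tend to the identity in the topology of \<open>G\<close> and
  \<open>(n + 1) (A n - 1)\<close> tends to \<open>X\<close>, then \<open>X\<close> lies in the Lie algebra. Indeed the powers of \<open>A n\<close>
  approximate \<open>exp (t X)\<close> and stay in a compact neighbourhood of the identity, on which the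
  topology of \<open>G\<close> coincides with that of the matrices. Closure of the Lie algebra
  under sums and brackets follows, and so does the fact that the logarithmic derivative of a curve in
  \<open>G\<close> lies in it. A Gronwall estimate along the segments of a chart then shows that a subspace
  invariant under the Lie algebra is invariant under a neighbourhood of the identity, hence under
  the connected group \<open>G\<close> (\<open>lie_algebra_invariant_imp_invariant\<close>).

  For the algebraic statement, orthogonal complements are invariant, so lines and hyperplanes are
  immediate and \<open>W\<close> may be taken of dimension two; its radical \<open>W \<inter> perp W\<close> is invariant and is a
  line, all of \<open>W\<close>, or zero. Put \<open>N = perp W\<close>. The last two cases share the following
  idea (\<open>invariant_line_of_transversal_orbit\<close>): if \<open>v\<close> lies outside \<open>N\<close> and \<open>g v\<close> contains a
  two-dimensional subspace of \<open>N\<close>, then for a two-dimensional orbit nothing else is left, so that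
  \<open>g v\<close> lies in \<open>N + span {v}\<close>, which is thus an invariant hyperplane.

  If \<open>W\<close> is totally isotropic, choose \<open>n\<close> with \<open>N = W + span {n}\<close>. The elements of \<open>g\<close> killing \<open>W\<close>
  map \<open>n\<close> onto an invariant subspace of \<open>W\<close>. If this is a line, it is the answer; if it is \<open>W\<close>, brackets
  produce enough vectors of \<open>g v\<close> in \<open>N\<close>. If it is zero, \<open>g\<close> acts on the affine plane \<open>n + W\<close> through its
  linear action on \<open>W\<close>, and vanishing of the first cohomology, proved by hand, gives a fixed point
  there or an invariant line in \<open>W\<close> (\<open>invariant_line_in_plane_extension\<close>).

  If \<open>W\<close> is nondegenerate, \<open>g\<close> acts on \<open>W\<close> by an algebra of dimension at most one, so the ideal \<open>g1\<close> of elements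
  killing \<open>W\<close> has codimension at most one. Infinitesimal isometries of the three-dimensional \<open>N\<close>
  correspond equivariantly to their axes, so \<open>g1\<close> becomes an invariant subspace of \<open>N\<close>. It is nonzero,
  since otherwise orbits would be at most one-dimensional; in dimension one or two it yields an
  invariant line; and if it is all of \<open>N\<close>, then \<open>g1 v\<close> is a
  two-dimensional subspace of \<open>N\<close> and the idea above applies.\<close>

section \<open>The matrix exponential\<close>

lemma bounded_bilinear_matrix_mult:
  "bounded_bilinear ((**) :: real^'n^'n \<Rightarrow> real^'n^'n \<Rightarrow> real^'n^'n)"
proof -
  have "bilinear ((**) :: real^'n^'n \<Rightarrow> real^'n^'n \<Rightarrow> real^'n^'n)"
    unfolding bilinear_def linear_iff
    by (auto simp: matrix_matrix_mult_def vec_eq_iff algebra_simps sum.distrib sum_distrib_left)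
  then show ?thesis by (simp add: bilinear_conv_bounded_bilinear)
qed

interpretation mm: bounded_bilinear "(**) :: real^'n^'n \<Rightarrow> real^'n^'n \<Rightarrow> real^'n^'n"
  by (rule bounded_bilinear_matrix_mult)

lemma bounded_bilinear_matrix_vector_mult:
  "bounded_bilinear ((*v) :: real^'n^'n \<Rightarrow> real^'n \<Rightarrow> real^'n)"
proof -
  have "bilinear ((*v) :: real^'n^'n \<Rightarrow> real^'n \<Rightarrow> real^'n)"
    unfolding bilinear_def linear_iff
    by (auto simp: matrix_vector_mult_def vec_eq_iff algebra_simps sum.distrib sum_distrib_left)
  then show ?thesis by (simp add: bilinear_conv_bounded_bilinear)
qed

interpretation mv: bounded_bilinear "(*v) :: real^'n^'n \<Rightarrow> real^'n \<Rightarrow> real^'n"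
  by (rule bounded_bilinear_matrix_vector_mult)

definition mpow :: "real^'n^'n \<Rightarrow> nat \<Rightarrow> real^'n^'n" where
  "mpow X n = ((\<lambda>B. X ** B) ^^ n) (mat 1)"

lemma mpow_0 [simp]: "mpow X 0 = mat 1"
  and mpow_Suc: "mpow X (Suc n) = X ** mpow X n"
  by (simp_all add: mpow_def)

lemma mpow_Suc2: "mpow X (Suc n) = mpow X n ** X"
  by (induction n) (simp_all add: mpow_Suc matrix_mul_assoc)

lemma mpow_scaleR: "mpow (t *\<^sub>R X) n = t ^ n *\<^sub>R mpow X n"
  by (induction n) (simp_all add: mpow_Suc mm.scaleR_left mm.scaleR_right)

text \<open>The vector type of matrices carries the componentwise product, not the structure of a normed algebra,
  so the exponential series is compared with a real one through the bound of the bilinear map \<open>**\<close>.\<close>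

lemma summable_matrix_exp_series:
  fixes X :: "real^'n^'n"
  shows "summable (\<lambda>n. mpow X n /\<^sub>R fact n)"
proof -
  obtain K where K: "\<And>A B. norm ((A::real^'n^'n) ** (B::real^'n^'n)) \<le> norm A * norm B * K" "0 \<le> K"
    using mm.nonneg_bounded by (elim exE conjE) blast
  have "norm (mpow X n) \<le> (norm X * K) ^ n * norm (mat 1 :: real^'n^'n)" for n
  proof (induction n)
    case (Suc n)
    have "norm (mpow X (Suc n)) \<le> norm X * norm (mpow X n) * K"
      by (simp add: mpow_Suc K)
    also have "\<dots> = (norm X * K) * norm (mpow X n)" by simp
    also have "\<dots> \<le> (norm X * K) * ((norm X * K) ^ n * norm (mat 1 :: real^'n^'n))"
      using Suc K(2) by (intro mult_left_mono) auto
    finally show ?case by (simp add: mult.assoc)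
  qed simp
  then have "norm (mpow X n /\<^sub>R fact n) \<le> (norm X * K) ^ n /\<^sub>R fact n * norm (mat 1 :: real^'n^'n)" for n
    by (simp add: field_simps)
  moreover have "summable (\<lambda>n. (norm X * K) ^ n /\<^sub>R fact n * norm (mat 1 :: real^'n^'n))"
    by (intro summable_mult2 summable_exp_generic)
  ultimately show ?thesis by (rule summable_comparison_test'[rotated])
qed

lemma matrix_exp_bounded_linear:
  assumes "bounded_linear f"
  shows "f (matrix_exp X) = (\<Sum>n. f (mpow X n /\<^sub>R fact n))"
  using bounded_linear.suminf[OF assms summable_matrix_exp_series]
  by (simp add: matrix_exp_def mpow_def)

lemma matrix_exp_0 [simp]: "matrix_exp 0 = (mat 1 :: real^'n^'n)"
proof -
  have "mpow 0 n /\<^sub>R fact n = (if n = 0 then mat 1 else (0::real^'n^'n))" for n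
    by (cases n) (simp_all add: mpow_Suc mm.zero_left)
  then show ?thesis
    using sums_unique[OF sums_single[of 0 "\<lambda>_. mat 1 :: real^'n^'n"]]
    unfolding matrix_exp_def mpow_def[symmetric] by simp
qed

lemma matrix_exp_commute: "X ** matrix_exp X = matrix_exp X ** X"
  using matrix_exp_bounded_linear[OF mm.bounded_linear_right, of X X]
    matrix_exp_bounded_linear[OF mm.bounded_linear_left, of X X]
  by (simp add: mm.scaleR_left mm.scaleR_right flip: mpow_Suc mpow_Suc2)

text \<open>Each coordinate of \<open>exp (t X)\<close> is an everywhere convergent real power series in \<open>t\<close>.\<close>

lemma matrix_exp_has_vector_derivative:
  fixes X :: "real^'n^'n"
  shows   "((\<lambda>t. matrix_exp (t *\<^sub>R X)) has_vector_derivative X ** matrix_exp (t *\<^sub>R X)) (at t)"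
  unfolding has_vector_derivative_def
proof (subst has_derivative_componentwise_within, intro ballI)
  fix i :: "real^'n^'n" assume "i \<in> Basis"
  define c where "c n = (mpow X n \<bullet> i) / fact n" for n
  have eq: "matrix_exp (s *\<^sub>R X) \<bullet> i = (\<Sum>n. c n * s ^ n)" for s
    using matrix_exp_bounded_linear[OF bounded_linear_inner_left, of "s *\<^sub>R X" i]
    by (simp add: mpow_scaleR c_def field_simps)
  have sm: "summable (\<lambda>n. c n * y ^ n)" for y
    using bounded_linear.summable[OF bounded_linear_inner_left summable_matrix_exp_series, of "y *\<^sub>R X" i]
    by (simp add: mpow_scaleR c_def field_simps)
  have "((\<lambda>s. \<Sum>n. c n * s ^ n) has_field_derivative (\<Sum>n. diffs c n * t ^ n)) (at t)"
    by (rule termdiffs_strong_converges_everywhere) (rule sm)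
  moreover have "(\<Sum>n. diffs c n * t ^ n) = (X ** matrix_exp (t *\<^sub>R X)) \<bullet> i"
  proof -
    have bl: "bounded_linear (\<lambda>A. (X ** A) \<bullet> i)"
      using bounded_linear_compose[OF bounded_linear_inner_left mm.bounded_linear_right] .
    have "(X ** (mpow (t *\<^sub>R X) n /\<^sub>R fact n)) \<bullet> i = diffs c n * t ^ n" for n
      by (simp add: diffs_def c_def mpow_scaleR mm.scaleR_right mpow_Suc field_simps del: of_nat_Suc)
    then show ?thesis
      using matrix_exp_bounded_linear[OF bl, of "t *\<^sub>R X"] by simp
  qed
  ultimately show "((\<lambda>x. matrix_exp (x *\<^sub>R X) \<bullet> i) has_derivative
      (\<lambda>x. (x *\<^sub>R (X ** matrix_exp (t *\<^sub>R X))) \<bullet> i)) (at t)"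
    by (simp add: eq has_field_derivative_def mult.commute[of _ "_ \<bullet> _"])
qed

lemma constant_if_vector_derivative_zero:
  fixes f :: "real \<Rightarrow> 'a::real_normed_vector"
  assumes "\<And>t. (f has_vector_derivative 0) (at t)"
  shows "f s = f t"
proof -
  obtain c where "\<And>x. x \<in> UNIV \<Longrightarrow> f x = c"
    using has_vector_derivative_zero_constant[of UNIV f] assms by auto
  then show ?thesis by simp
qed

lemma matrix_exp_neg_has_vector_derivative:
  fixes X :: "real^'n^'n"
  shows "((\<lambda>t. matrix_exp (- (t *\<^sub>R X))) has_vector_derivative - (matrix_exp (- (t *\<^sub>R X)) ** X)) (at t)"
proof -
  have "matrix_exp (- (t *\<^sub>R X)) ** X = X ** matrix_exp (- (t *\<^sub>R X))" (is "?l = _")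
  proof (cases "t = 0")
    case False
    have "t *\<^sub>R (X ** matrix_exp (- (t *\<^sub>R X))) = t *\<^sub>R (matrix_exp (- (t *\<^sub>R X)) ** X)"
      using matrix_exp_commute[of "- (t *\<^sub>R X)"]
      by (simp add: mm.minus_left mm.minus_right mm.scaleR_left mm.scaleR_right)
    with False show ?thesis by simp
  qed simp
  with matrix_exp_has_vector_derivative[of "- X" t] show ?thesis
    by (simp add: mm.minus_left)
qed

text \<open>The derivative of \<open>exp (- t X) M(t)\<close> vanishes. This uniqueness is what yields the functional
  equation and the behaviour under conjugation below.\<close>

lemma linear_ode_unique:
  fixes X :: "real^'n^'n" and M :: "real \<Rightarrow> real^'n^'n"
  assumes "\<And>t. (M has_vector_derivative X ** M t) (at t)"
  shows "matrix_exp (- (t *\<^sub>R X)) ** M t = M 0"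
proof -
  have "((\<lambda>t. matrix_exp (- (t *\<^sub>R X)) ** M t) has_vector_derivative 0) (at s)" for s
    using mm.has_vector_derivative[OF matrix_exp_neg_has_vector_derivative assms, of X s]
    by (simp add: mm.minus_left matrix_mul_assoc)
  from constant_if_vector_derivative_zero[OF this, of t 0] show ?thesis by simp
qed

lemma matrix_exp_inverse:
  "matrix_exp (- X) ** matrix_exp X = mat 1" "matrix_exp X ** matrix_exp (- X) = mat 1"
proof -
  have *: "matrix_exp (- X) ** matrix_exp X = mat 1" for X :: "real^'n^'n"
    using linear_ode_unique[OF matrix_exp_has_vector_derivative, of 1 X] by simp
  show "matrix_exp (- X) ** matrix_exp X = mat 1" "matrix_exp X ** matrix_exp (- X) = mat 1"
    using *[of X] *[of "- X"] by simp_all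
qed

lemma linear_ode_solution:
  fixes X :: "real^'n^'n" and M :: "real \<Rightarrow> real^'n^'n"
  assumes "\<And>t. (M has_vector_derivative X ** M t) (at t)"
  shows "M t = matrix_exp (t *\<^sub>R X) ** M 0"
  by (simp add: linear_ode_unique[OF assms, of t, symmetric] matrix_mul_assoc matrix_exp_inverse)

lemma matrix_exp_add:
  "matrix_exp ((s + t) *\<^sub>R X) = matrix_exp (s *\<^sub>R X) ** matrix_exp (t *\<^sub>R X)"
proof -
  have "((\<lambda>s. matrix_exp ((s + t) *\<^sub>R X)) has_vector_derivative X ** matrix_exp ((s + t) *\<^sub>R X)) (at s)" for s
  proof -
    have "((\<lambda>s. s + t) has_vector_derivative 1) (at s)"
      by (simp add: has_vector_derivative_add_const)
    from vector_diff_chain_at[OF this matrix_exp_has_vector_derivative, of X] show ?thesis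
      by (simp add: o_def)
  qed
  from linear_ode_solution[OF this, of s] show ?thesis by simp
qed

lemma matrix_exp_conjugate:
  fixes A B X :: "real^'n^'n"
  assumes "B ** A = mat 1"
  shows "A ** matrix_exp (t *\<^sub>R X) ** B = matrix_exp (t *\<^sub>R (A ** X ** B))"
proof -
  have AB: "A ** B = mat 1" using assms by (simp add: matrix_left_right_inverse)
  have "((\<lambda>t. A ** matrix_exp (t *\<^sub>R X) ** B) has_vector_derivative
      A ** X ** B ** (A ** matrix_exp (t *\<^sub>R X) ** B)) (at t)" for t
  proof -
    have "A ** X ** B ** (A ** matrix_exp (t *\<^sub>R X) ** B)
        = A ** X ** (B ** A) ** matrix_exp (t *\<^sub>R X) ** B"
      by (simp only: matrix_mul_assoc)
    then show ?thesis
      using mm.has_vector_derivative[OF mm.has_vector_derivative[OF has_vector_derivative_const[of A]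
        matrix_exp_has_vector_derivative] has_vector_derivative_const[of B], of X t]
      by (simp add: assms matrix_mul_assoc)
  qed
  from linear_ode_solution[OF this, of t] show ?thesis by (simp add: AB)
qed

lemma mpow_matrix_exp: "mpow (matrix_exp (t *\<^sub>R X)) k = matrix_exp ((real k * t) *\<^sub>R X)"
  by (induction k) (simp_all add: mpow_Suc distrib_right matrix_exp_add)

text \<open>Derivatives are only needed along the sequence \<open>1 / (n + 1)\<close>, the form in which they enter
  von Neumann's argument.\<close>

lemma vector_derivative_imp_sequence:
  assumes "(f has_vector_derivative D) (at t)"
  shows "(\<lambda>n. real (Suc n) *\<^sub>R (f (t + 1 / real (Suc n)) - f t)) \<longlonglongrightarrow> D"
proof -
  have "((\<lambda>h. (f (t + h) - f t) /\<^sub>R h) \<longlongrightarrow> D) (at 0)"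
    using assms unfolding has_vector_derivative_def has_derivative_at
    proof (elim conjE)
    assume "(\<lambda>h. norm (f (t + h) - f t - h *\<^sub>R D) / norm h) \<midarrow>0\<rightarrow> 0"
    moreover have "norm ((f (t + h) - f t) /\<^sub>R h - D) = norm (f (t + h) - f t - h *\<^sub>R D) / norm h" if "h \<noteq> 0" for h
    proof -
      have "(f (t + h) - f t) /\<^sub>R h - D = (f (t + h) - f t - h *\<^sub>R D) /\<^sub>R h"
        using that by (simp add: algebra_simps)
      then show ?thesis by (simp add: divide_inverse mult.commute)
    qed
    ultimately have "((\<lambda>h. norm ((f (t + h) - f t) /\<^sub>R h - D)) \<longlongrightarrow> 0) (at 0)"
      by (simp cong: LIM_cong)
    then show ?thesis by (simp add: tendsto_norm_zero_iff LIM_zero_iff)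
  qed
  moreover have "filterlim (\<lambda>n. 1 / real (Suc n)) (at 0) sequentially"
    using LIMSEQ_inverse_real_of_nat by (simp add: filterlim_at inverse_eq_divide)
  ultimately have "((\<lambda>n. (f (t + 1 / real (Suc n)) - f t) /\<^sub>R (1 / real (Suc n))) \<longlongrightarrow> D) sequentially"
    by (rule filterlim_compose)
  then show ?thesis by (simp add: inverse_eq_divide)
qed

section \<open>Powers of matrices close to the identity\<close>

text \<open>A telescoping estimate. The growth factor is written as \<open>1 + c\<close> with \<open>c\<close> bounding the distance to the
  identity, because the norm of the identity and the constant of the bilinear map exceed one in
  general and must not be raised to the power \<open>k\<close>.\<close>

lemma mpow_diff_bound:
  obtains L where "0 \<le> L"
    "\<And>(A::real^'n^'n) B c k. 0 \<le> c \<Longrightarrow> L * norm (A - mat 1) \<le> c \<Longrightarrow> L * norm (B - mat 1) \<le> c \<Longrightarrow>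
       norm (mpow A k - mpow B k) \<le> real k * (L * norm (A - B)) * (1 + c) ^ k"
proof -
  obtain K where K: "\<And>A B. norm ((A::real^'n^'n) ** (B::real^'n^'n)) \<le> norm A * norm B * K" "0 \<le> K"
    using mm.nonneg_bounded by (elim exE conjE) blast
  define I where "I = norm (mat 1 :: real^'n^'n)"
  have P: "norm (mpow A k) \<le> (1 + c) ^ k * I" if "K * norm (A - mat 1) \<le> c" "0 \<le> c"
    for A :: "real^'n^'n" and c k
  proof (induction k)
    case (Suc k)
    have "mpow A (Suc k) = mpow A k + (A - mat 1) ** mpow A k"
      by (simp add: mpow_Suc mm.diff_left)
    then have "norm (mpow A (Suc k)) \<le> norm (mpow A k) + (K * norm (A - mat 1)) * norm (mpow A k)"
      using norm_triangle_ineq[of "mpow A k" "(A - mat 1) ** mpow A k"] K(1)[of "A - mat 1" "mpow A k"]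
      by (simp add: mult_ac)
    also have "\<dots> \<le> norm (mpow A k) + c * norm (mpow A k)"
      using that by (simp add: mult_right_mono)
    also have "\<dots> = (1 + c) * norm (mpow A k)" by (simp add: algebra_simps)
    also have "\<dots> \<le> (1 + c) * ((1 + c) ^ k * I)" using Suc that by (intro mult_left_mono) auto
    finally show ?case by (simp add: mult.assoc)
  qed (simp add: I_def)
  have D: "norm (mpow A k - mpow B k) \<le> real k * (K * norm (A - B)) * I * (1 + c) ^ k"
    if "K * norm (A - mat 1) \<le> c" "K * norm (B - mat 1) \<le> c" "0 \<le> c"
    for A B :: "real^'n^'n" and c k
  proof (induction k)
    case (Suc k)
    let ?D = "mpow A k - mpow B k" and ?e = "K * norm (A - B)"
    have "mpow A (Suc k) - mpow B (Suc k) = (A - B) ** mpow A k + (B - mat 1) ** ?D + ?D"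
      by (simp add: mpow_Suc mm.diff_left mm.diff_right)
    then have "norm (mpow A (Suc k) - mpow B (Suc k))
        \<le> norm ((A - B) ** mpow A k) + norm ((B - mat 1) ** ?D) + norm ?D"
      using norm_triangle_ineq[of "(A - B) ** mpow A k + (B - mat 1) ** ?D" ?D]
        norm_triangle_ineq[of "(A - B) ** mpow A k" "(B - mat 1) ** ?D"] by simp
    also have "\<dots> \<le> ?e * norm (mpow A k) + K * norm (B - mat 1) * norm ?D + norm ?D"
      using K(1)[of "A - B" "mpow A k"] K(1)[of "B - mat 1" ?D] by (simp add: mult_ac)
    also have "\<dots> \<le> ?e * ((1 + c) ^ k * I) + c * norm ?D + norm ?D"
      using that K(2) P[OF that(1,3), of k] by (intro add_mono mult_left_mono mult_right_mono) auto
    also have "\<dots> \<le> ?e * I * (1 + c) ^ Suc k + (1 + c) * (real k * ?e * I * (1 + c) ^ k)"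
    proof -
      have "?e * I * (1 + c) ^ k * 1 \<le> ?e * I * (1 + c) ^ k * (1 + c)"
        using that K(2) by (intro mult_left_mono) (auto simp: I_def)
      moreover have "(1 + c) * norm ?D \<le> (1 + c) * (real k * ?e * I * (1 + c) ^ k)"
        using that Suc by (intro mult_left_mono) auto
      ultimately show ?thesis by (simp add: algebra_simps)
    qed
    also have "\<dots> = real (Suc k) * ?e * I * (1 + c) ^ Suc k" by (simp add: algebra_simps)
    finally show ?case .
  qed simp
  define L where "L = max K (K * I)"
  show thesis
  proof
    show "0 \<le> L" using K by (simp add: L_def)
    fix A B :: "real^'n^'n" and c k
    assume c: "0 \<le> c" "L * norm (A - mat 1) \<le> c" "L * norm (B - mat 1) \<le> c"
    have KL: "K * norm M \<le> L * norm M" "K * norm M * I \<le> L * norm M" for M :: "real^'n^'n"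
    proof -
      show "K * norm M \<le> L * norm M" unfolding L_def by (intro mult_right_mono) auto
      have "K * I * norm M \<le> L * norm M" unfolding L_def by (intro mult_right_mono) auto
      then show "K * norm M * I \<le> L * norm M" by (simp add: mult_ac)
    qed
    have "norm (mpow A k - mpow B k) \<le> real k * (K * norm (A - B)) * I * (1 + c) ^ k"
      using c KL(1)[of "A - mat 1"] KL(1)[of "B - mat 1"] by (intro D) auto
    also have "\<dots> = real k * (K * norm (A - B) * I) * (1 + c) ^ k" by simp
    also have "\<dots> \<le> real k * (L * norm (A - B)) * (1 + c) ^ k"
      using c KL(2) by (intro mult_left_mono mult_right_mono) auto
    finally show "norm (mpow A k - mpow B k) \<le> real k * (L * norm (A - B)) * (1 + c) ^ k" .
  qed
qed

text \<open>For distances of order \<open>1 / n\<close> and exponents \<open>k\<close> of order \<open>n\<close> the growth factor stays bounded.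
  The sequence \<open>B\<close> will be \<open>exp (X / (n + 1))\<close> to identify the limit of the powers, and the constant
  sequence at the identity to keep the powers close to it for short times.\<close>

lemma mpow_sequence_bound:
  fixes X Y :: "real^'n^'n"
  assumes A: "(\<lambda>n. real (Suc n) *\<^sub>R (A n - mat 1)) \<longlonglongrightarrow> X"
    and B: "(\<lambda>n. real (Suc n) *\<^sub>R (B n - mat 1)) \<longlonglongrightarrow> Y"
  obtains C where "0 \<le> C"
    "\<And>n k t. 0 \<le> t \<Longrightarrow> real k \<le> t * real (Suc n) \<Longrightarrow>
       norm (mpow (A n) k - mpow (B n) k) \<le> t * exp (C * t) * (C * norm (real (Suc n) *\<^sub>R (A n - B n)))"
proof -
  obtain L where L: "0 \<le> L"
    "\<And>(A::real^'n^'n) B c k. 0 \<le> c \<Longrightarrow> L * norm (A - mat 1) \<le> c \<Longrightarrow> L * norm (B - mat 1) \<le> c \<Longrightarrow>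
       norm (mpow A k - mpow B k) \<le> real k * (L * norm (A - B)) * (1 + c) ^ k"
    using mpow_diff_bound by blast
  have "Bseq (\<lambda>n. real (Suc n) *\<^sub>R (A n - mat 1))" "Bseq (\<lambda>n. real (Suc n) *\<^sub>R (B n - mat 1))"
    using A B by (auto intro!: convergent_imp_Bseq convergentI)
  then obtain CA CB where C: "0 < CA" "0 < CB" "\<And>n. real (Suc n) * norm (A n - mat 1) \<le> CA"
    "\<And>n. real (Suc n) * norm (B n - mat 1) \<le> CB"
    by (auto simp: Bseq_def simp del: of_nat_Suc)
  define C where "C = L * max 1 (max CA CB)"
  have C0: "0 \<le> C" "L \<le> C" using C L mult_left_mono[of 1 "max 1 (max CA CB)" L] by (auto simp: C_def)
  have AC: "L * norm (A n - mat 1) \<le> C / real (Suc n)" for n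
    using mult_left_mono[of "real (Suc n) * norm (A n - mat 1)" "max 1 (max CA CB)" L] C(3)[of n] L(1)
    by (simp add: C_def field_simps del: of_nat_Suc)
  have BC: "L * norm (B n - mat 1) \<le> C / real (Suc n)" for n
    using mult_left_mono[of "real (Suc n) * norm (B n - mat 1)" "max 1 (max CA CB)" L] C(4)[of n] L(1)
    by (simp add: C_def field_simps del: of_nat_Suc)
  show thesis
  proof
    show "0 \<le> C" by (fact C0)
    fix n k and t :: real assume t: "0 \<le> t" and k: "real k \<le> t * real (Suc n)"
    let ?c = "C / real (Suc n)"
    have c0: "0 \<le> ?c" using C0 by simp
    have "(1 + ?c) ^ k \<le> exp ?c ^ k" using c0 by (intro power_mono) auto
    also have "\<dots> = exp (real k * ?c)" by (rule exp_of_nat_mult[symmetric])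
    also have "\<dots> \<le> exp (C * t)"
      using mult_right_mono[OF k c0] by (simp add: field_simps del: of_nat_Suc)
    finally have e: "(1 + ?c) ^ k \<le> exp (C * t)" .
    have "norm (mpow (A n) k - mpow (B n) k) \<le> real k * (L * norm (A n - B n)) * (1 + ?c) ^ k"
      by (rule L(2)[OF c0 AC BC])
    also have "\<dots> \<le> t * real (Suc n) * (C * norm (A n - B n)) * exp (C * t)"
      using e k L(1) t c0 C0 by (intro mult_mono mult_nonneg_nonneg) (auto simp del: of_nat_Suc)
    also have "\<dots> = t * exp (C * t) * (C * norm (real (Suc n) *\<^sub>R (A n - B n)))"
      by (simp add: mult_ac del: of_nat_Suc)
    finally show "norm (mpow (A n) k - mpow (B n) k) \<le> t * exp (C * t) * (C * norm (real (Suc n) *\<^sub>R (A n - B n)))" .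
  qed
qed

text \<open>The multiplicative form of Euler's method for \<open>M' = X M\<close>.\<close>

lemma mpow_limit:
  fixes X :: "real^'n^'n"
  assumes A: "(\<lambda>n. real (Suc n) *\<^sub>R (A n - mat 1)) \<longlonglongrightarrow> X" and t: "0 \<le> t"
  shows "(\<lambda>n. mpow (A n) (nat \<lfloor>t * real (Suc n)\<rfloor>)) \<longlonglongrightarrow> matrix_exp (t *\<^sub>R X)"
proof -
  define B where "B n = matrix_exp ((1 / real (Suc n)) *\<^sub>R X)" for n
  define k where "k n = nat \<lfloor>t * real (Suc n)\<rfloor>" for n
  have k: "real (k n) \<le> t * real (Suc n)" for n using t by (simp add: k_def)
  have B: "(\<lambda>n. real (Suc n) *\<^sub>R (B n - mat 1)) \<longlonglongrightarrow> X"
    using vector_derivative_imp_sequence[OF matrix_exp_has_vector_derivative[of X 0]]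
    by (simp add: B_def)
  obtain C where "0 \<le> C" and C:
    "\<And>n k t. 0 \<le> t \<Longrightarrow> real k \<le> t * real (Suc n) \<Longrightarrow>
       norm (mpow (A n) k - mpow (B n) k) \<le> t * exp (C * t) * (C * norm (real (Suc n) *\<^sub>R (A n - B n)))"
    using mpow_sequence_bound[OF A B] by blast
  have "(\<lambda>n. real (Suc n) *\<^sub>R (A n - mat 1) - real (Suc n) *\<^sub>R (B n - mat 1)) \<longlonglongrightarrow> X - X"
    by (intro tendsto_intros A B)
  then have "(\<lambda>n. real (Suc n) *\<^sub>R (A n - B n)) \<longlonglongrightarrow> 0"
    by (simp add: scaleR_diff_right)
  then have "(\<lambda>n. t * exp (C * t) * (C * norm (real (Suc n) *\<^sub>R (A n - B n)))) \<longlonglongrightarrow> t * exp (C * t) * (C * norm (0::real^'n^'n))"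
    by (intro tendsto_intros)
  then have "(\<lambda>n. mpow (A n) (k n) - mpow (B n) (k n)) \<longlonglongrightarrow> 0"
    by (intro Lim_null_comparison[OF always_eventually[OF allI, OF C[OF t k]]]) simp
  moreover have "(\<lambda>n. mpow (B n) (k n)) \<longlonglongrightarrow> matrix_exp (t *\<^sub>R X)"
  proof -
    have "(\<lambda>n. real (k n) / real (Suc n)) \<longlonglongrightarrow> t"
    proof (rule tendsto_sandwich)
      have "(\<lambda>n. t - 1 / real (Suc n)) \<longlonglongrightarrow> t - 0"
        using LIMSEQ_inverse_real_of_nat by (intro tendsto_intros) (simp add: inverse_eq_divide)
      then show "(\<lambda>n. t - 1 / real (Suc n)) \<longlonglongrightarrow> t" by simp
      show "\<forall>\<^sub>F n in sequentially. t - 1 / real (Suc n) \<le> real (k n) / real (Suc n)"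
      proof (rule always_eventually, rule allI)
        fix n
        have "t * real (Suc n) - 1 \<le> real (k n)" using t unfolding k_def by linarith
        then have "(t * real (Suc n) - 1) / real (Suc n) \<le> real (k n) / real (Suc n)"
          by (intro divide_right_mono) auto
        then show "t - 1 / real (Suc n) \<le> real (k n) / real (Suc n)"
          by (simp add: diff_divide_distrib del: of_nat_Suc)
      qed
      show "\<forall>\<^sub>F n in sequentially. real (k n) / real (Suc n) \<le> t"
        using k by (simp add: divide_le_eq del: of_nat_Suc)
      show "(\<lambda>n. t) \<longlonglongrightarrow> t" by simp
    qed
    moreover have "isCont (\<lambda>s. matrix_exp (s *\<^sub>R X)) t"
      by (rule has_vector_derivative_continuous[OF matrix_exp_has_vector_derivative])
    ultimately have "(\<lambda>n. matrix_exp ((real (k n) / real (Suc n)) *\<^sub>R X)) \<longlonglongrightarrow> matrix_exp (t *\<^sub>R X)"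
      by (rule isCont_tendsto_compose[rotated])
    then show ?thesis by (simp add: B_def mpow_matrix_exp)
  qed
  ultimately have "(\<lambda>n. (mpow (A n) (k n) - mpow (B n) (k n)) + mpow (B n) (k n)) \<longlonglongrightarrow> 0 + matrix_exp (t *\<^sub>R X)"
    by (rule tendsto_add)
  then show ?thesis by (simp add: k_def)
qed

section \<open>Matrix Lie groups as locally compact groups\<close>

lemma matrix_inv_mult:
  assumes "invertible (A :: real^'n^'n)"
  shows "A ** matrix_inv A = mat 1" "matrix_inv A ** A = mat 1"
  using someI_ex[OF assms[unfolded invertible_def]] by (auto simp: matrix_inv_def)

lemma matrix_inv_unique_left:
  fixes A B :: "real^'n^'n"
  assumes "B ** A = mat 1"
  shows "matrix_inv A = B"
proof -
  have "invertible A" using assms matrix_left_right_inverse[of B A] by (auto simp: invertible_def)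
  then have "B ** (A ** matrix_inv A) = B" by (simp add: matrix_inv_mult)
  with assms show ?thesis by (simp add: matrix_mul_assoc)
qed

lemma Ck_on_subset: "Ck_on k V U f \<Longrightarrow> U' \<subseteq> U \<Longrightarrow> Ck_on k V U' f"
proof (induction k arbitrary: f)
  case (Suc k)
  have "\<exists>f'. (\<forall>u\<in>U'. ((\<lambda>t. f (u + t *\<^sub>R v)) has_vector_derivative f' u) (at 0)) \<and> Ck_on k V U' f'"
    if "v \<in> V" for v
    using Suc that by (auto dest!: bspec[of V _ v])
  then show ?case using Suc.prems by (auto intro: continuous_on_subset)
qed (auto intro: continuous_on_subset)

locale matrix_lie_group =
  fixes G :: "(real^'n^'n) topology"
  assumes lie_subgroup: "lie_subgroup G"
begin

lemma invertible: "A \<in> topspace G \<Longrightarrow> invertible A"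
  and one_in: "mat 1 \<in> topspace G"
  and mult_continuous: "continuous_map (prod_topology G G) G (\<lambda>(A, B). A ** B)"
  and inv_continuous: "continuous_map G G matrix_inv"
  using lie_subgroup by (auto simp: lie_subgroup_def)

lemma chart:
  assumes "A \<in> topspace G"
  obtains V :: "(real^'n^'n) set" and U \<phi> where "subspace V" "openin (top_of_set V) U" "A \<in> \<phi> ` U" "openin G (\<phi> ` U)"
    "homeomorphic_map (top_of_set U) (subtopology G (\<phi> ` U)) \<phi>" "smooth_immersion_on V U \<phi>"
proof -
  obtain V :: "(real^'n^'n) set" where V: "subspace V" "\<forall>A\<in>topspace G. \<exists>U \<phi>. openin (top_of_set V) U \<and>
           A \<in> \<phi> ` U \<and> openin G (\<phi> ` U) \<and>
           homeomorphic_map (top_of_set U) (subtopology G (\<phi> ` U)) \<phi> \<and>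
           smooth_immersion_on V U \<phi>"
    using lie_subgroup unfolding lie_subgroup_def by (elim conjE exE) (rule that; assumption)
  show thesis using V(1) bspec[OF V(2) assms] that by blast
qed

lemma mult_in: "A \<in> topspace G \<Longrightarrow> B \<in> topspace G \<Longrightarrow> A ** B \<in> topspace G"
  using continuous_map_image_subset_topspace[OF mult_continuous] by force

lemma inv_in: "A \<in> topspace G \<Longrightarrow> matrix_inv A \<in> topspace G"
  using continuous_map_image_subset_topspace[OF inv_continuous] by force

lemma inv_mult: "A \<in> topspace G \<Longrightarrow> A ** matrix_inv A = mat 1"
  "A \<in> topspace G \<Longrightarrow> matrix_inv A ** A = mat 1"
  by (simp_all add: matrix_inv_mult invertible)

lemma mpow_in: "A \<in> topspace G \<Longrightarrow> mpow A k \<in> topspace G"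
  by (induction k) (simp_all add: mpow_Suc one_in mult_in)

lemma continuous_map_mult:
  assumes "continuous_map X G f" "continuous_map X G g"
  shows "continuous_map X G (\<lambda>x. f x ** g x)"
proof -
  have "continuous_map X (prod_topology G G) (\<lambda>x. (f x, g x))"
    using assms by (simp add: continuous_map_pairwise o_def)
  from continuous_map_compose[OF this mult_continuous] show ?thesis by (simp add: o_def)
qed

lemma limitin_mult:
  assumes "limitin G f a F" "limitin G g b F"
  shows "limitin G (\<lambda>x. f x ** g x) (a ** b) F"
proof -
  have "limitin (prod_topology G G) (\<lambda>x. (f x, g x)) (a, b) F"
    using assms by (simp add: limitin_pairwise o_def)
  from continuous_map_limit[OF mult_continuous this] show ?thesis by (simp add: o_def)
qed

lemma left_mult_open:
  assumes "A \<in> topspace G" "openin G S"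
  shows "openin G {B \<in> topspace G. A ** B \<in> S}"
  using openin_continuous_map_preimage[OF continuous_map_mult[OF _ continuous_map_id] assms(2), of "\<lambda>_. A"]
    assms(1) by simp

text \<open>Locally the inclusion is a chart, continuous as a matrix-valued map, composed with the inverse of the
  same chart as a homeomorphism into \<open>G\<close>.\<close>

lemma inclusion_continuous: "continuous_map G euclidean (\<lambda>A. A)"
  unfolding continuous_map_def
proof (intro conjI allI impI)
  fix S :: "(real^'n^'n) set" assume "openin euclidean S"
  then have S: "open S" by simp
  show "openin G {A \<in> topspace G. A \<in> S}"
  proof (subst openin_subopen, intro ballI)
    fix A assume A: "A \<in> {A \<in> topspace G. A \<in> S}"
    then obtain V :: "(real^'n^'n) set" and U \<phi> where c: "openin (top_of_set V) U" "A \<in> \<phi> ` U" "openin G (\<phi> ` U)"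
      "homeomorphic_map (top_of_set U) (subtopology G (\<phi> ` U)) \<phi>" "smooth_immersion_on V U \<phi>"
      using chart[of A] by (metis (no_types, lifting) mem_Collect_eq)
    have "continuous_on U \<phi>" using c(5) by (auto simp: smooth_immersion_on_def dest: spec[of _ 0])
    then have "openin (top_of_set U) (U \<inter> \<phi> -` S)"
      using S by (rule continuous_openin_preimage_gen)
    then have "openin (subtopology G (\<phi> ` U)) (\<phi> ` (U \<inter> \<phi> -` S))"
      using homeomorphic_map_openness_eq[OF c(4)] by blast
    then have "openin G (\<phi> ` (U \<inter> \<phi> -` S))"
      using c(3) openin_trans_full by blast
    moreover have "A \<in> \<phi> ` (U \<inter> \<phi> -` S)" using A c(2) by auto
    moreover have "\<phi> ` (U \<inter> \<phi> -` S) \<subseteq> {A \<in> topspace G. A \<in> S}"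
      using openin_subset[OF c(3)] by auto
    ultimately show "\<exists>T. openin G T \<and> A \<in> T \<and> T \<subseteq> {A \<in> topspace G. A \<in> S}" by blast
  qed
qed auto

lemma compact_in_matrices: "compactin G K \<Longrightarrow> compact K"
  using image_compactin[OF _ inclusion_continuous] by fastforce

lemma identity_chart:
  obtains V :: "(real^'n^'n) set" and u e \<phi> where "subspace V" "u \<in> V" "0 < e" "\<phi> u = mat 1"
    "openin G (\<phi> ` (ball u e \<inter> V))" "compactin G (\<phi> ` (cball u e \<inter> V))"
    "continuous_map (top_of_set (ball u e \<inter> V)) G \<phi>"
    "\<And>k. Ck_on k V (ball u e \<inter> V) \<phi>"
proof -
  obtain V :: "(real^'n^'n) set" and U \<phi> where c: "subspace V" "openin (top_of_set V) U" "mat 1 \<in> \<phi> ` U" "openin G (\<phi> ` U)"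
    "homeomorphic_map (top_of_set U) (subtopology G (\<phi> ` U)) \<phi>" "smooth_immersion_on V U \<phi>"
    using chart[OF one_in] by metis
  then obtain u where u: "u \<in> U" "\<phi> u = mat 1" by auto
  obtain e where e: "0 < e" "cball u e \<inter> V \<subseteq> U" and UV: "U \<subseteq> V"
    using c(2) u(1) unfolding openin_contains_cball by blast
  have bU: "ball u e \<inter> V \<subseteq> U" using e(2) ball_subset_cball by blast
  have cont: "continuous_map (top_of_set U) G \<phi>"
    using homeomorphic_imp_continuous_map[OF c(5)] by (simp add: continuous_map_in_subtopology)
  show thesis
  proof
    show "openin G (\<phi> ` (ball u e \<inter> V))"
    proof -
      have "ball u e \<inter> V = U \<inter> ball u e" using bU UV by auto
      then have "openin (top_of_set U) (ball u e \<inter> V)" by (auto simp: openin_open)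
      then have "openin (subtopology G (\<phi> ` U)) (\<phi> ` (ball u e \<inter> V))"
        using homeomorphic_map_openness_eq[OF c(5)] by blast
      then show ?thesis using c(4) openin_trans_full by blast
    qed
    show "compactin G (\<phi> ` (cball u e \<inter> V))"
    proof (rule image_compactin[OF _ cont])
      show "compactin (top_of_set U) (cball u e \<inter> V)"
        using e(2) c(1) by (simp add: compactin_subtopology compact_Int_closed closed_subspace)
    qed
    show "continuous_map (top_of_set (ball u e \<inter> V)) G \<phi>"
      using continuous_map_from_subtopology_mono[OF cont bU] .
    show "Ck_on k V (ball u e \<inter> V) \<phi>" for k
      using c(6) bU by (auto simp: smooth_immersion_on_def intro: Ck_on_subset)
  qed (use c u UV e in auto)
qed

lemma compact_neighbourhood:
  obtains W K where "openin G W" "mat 1 \<in> W" "W \<subseteq> K" "compactin G K"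
proof -
  obtain V :: "(real^'n^'n) set" and u e \<phi> where "u \<in> V" "0 < e" "\<phi> u = mat 1"
    "openin G (\<phi> ` (ball u e \<inter> V))" "compactin G (\<phi> ` (cball u e \<inter> V))"
    using identity_chart by metis
  moreover from this have "mat 1 \<in> \<phi> ` (ball u e \<inter> V)" by (metis IntI centre_in_ball image_eqI)
  moreover have "\<phi> ` (ball u e \<inter> V) \<subseteq> \<phi> ` (cball u e \<inter> V)" by auto
  ultimately show thesis using that by blast
qed

text \<open>On a compact set the finer topology of \<open>G\<close> agrees with that of the matrices. This is how
  closeness of matrices becomes closeness in \<open>G\<close> although \<open>G\<close> need not be closed or embedded.\<close>

lemma compact_neighbourhood_detects_identity:
  assumes K: "compactin G K" and W: "openin G W" "mat 1 \<in> W"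
  obtains d where "0 < d" "\<And>A. A \<in> K \<Longrightarrow> norm (A - mat 1) < d \<Longrightarrow> A \<in> W"
proof -
  have "compactin G (K \<inter> (topspace G - W))"
    using K W by (intro compact_Int_closedin) auto
  then have "closed (K \<inter> (topspace G - W))"
    by (intro compact_imp_closed compact_in_matrices)
  moreover have "mat 1 \<notin> K \<inter> (topspace G - W)" using W by auto
  ultimately obtain d where d: "0 < d" "\<forall>A\<in>K \<inter> (topspace G - W). d \<le> dist (mat 1) A"
    using separate_point_closed by blast
  show thesis
  proof
    fix A assume "A \<in> K" "norm (A - mat 1) < d"
    then show "A \<in> W"
      using d(2) compactin_subset_topspace[OF K] by (force simp: dist_norm norm_minus_commute)
  qed (fact d)
qed

text \<open>Continuity at zero from the right suffices: inversion gives the left side, taking powers shows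
  that all of the one-parameter group lies in \<open>G\<close>, and translations spread the continuity.\<close>

lemma one_parameter_in_lie_algebra:
  assumes loc: "\<And>W. openin G W \<Longrightarrow> mat 1 \<in> W \<Longrightarrow> \<exists>d>0. \<forall>s. 0 \<le> s \<and> s < d \<longrightarrow> matrix_exp (s *\<^sub>R X) \<in> W"
  shows "X \<in> lie_algebra G"
proof -
  let ?E = "\<lambda>t. matrix_exp (t *\<^sub>R X)"
  have loc2: "\<exists>d>0. \<forall>s. \<bar>s\<bar> < d \<longrightarrow> ?E s \<in> W" if W: "openin G W" "mat 1 \<in> W" for W
  proof -
    let ?W = "W \<inter> {A \<in> topspace G. matrix_inv A \<in> W}"
    have "openin G ?W" using W openin_continuous_map_preimage[OF inv_continuous] by blast
    moreover have "mat 1 \<in> ?W" using W one_in matrix_inv_unique_left[of "mat 1 :: real^'n^'n" "mat 1"] by simp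
    ultimately obtain d where d: "d > 0" "\<And>s. 0 \<le> s \<Longrightarrow> s < d \<Longrightarrow> ?E s \<in> ?W" using loc by blast
    have "?E s \<in> W" if "\<bar>s\<bar> < d" for s
    proof (cases "0 \<le> s")
      case False
      have "matrix_inv (?E (- s)) = ?E s"
        using matrix_exp_inverse(1)[of "- s *\<^sub>R X"] by (intro matrix_inv_unique_left) simp
      with d(2)[of "- s"] False that show ?thesis by auto
    qed (use d that in auto)
    with d(1) show ?thesis by blast
  qed
  have inG: "?E t \<in> topspace G" for t
  proof -
    obtain d where d: "d > 0" "\<And>s. \<bar>s\<bar> < d \<Longrightarrow> ?E s \<in> topspace G"
      using loc2[of "topspace G"] one_in by auto
    obtain m where m: "\<bar>t\<bar> / d < real m" using reals_Archimedean2 by blast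
    then have "m > 0" using d(1) by (cases m) (auto simp: field_simps)
    have "mpow (?E (t / real m)) m \<in> topspace G"
      using m d(1) \<open>m > 0\<close> by (intro mpow_in d(2)) (auto simp: field_simps)
    with \<open>m > 0\<close> show ?thesis by (simp add: mpow_matrix_exp)
  qed
  have "open {t. ?E t \<in> S}" if S: "openin G S" for S
    unfolding open_dist
  proof (intro ballI)
    fix t assume "t \<in> {t. ?E t \<in> S}"
    then have "mat 1 \<in> {B \<in> topspace G. ?E t ** B \<in> S}" using one_in by simp
    from loc2[OF left_mult_open[OF inG S] this]
    obtain d where d: "d > 0" "\<And>s. \<bar>s\<bar> < d \<Longrightarrow> ?E t ** ?E s \<in> S" by auto
    have "?E s \<in> S" if "dist s t < d" for s
      using d(2)[of "s - t"] that by (simp add: dist_real_def flip: matrix_exp_add)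
    with d(1) show "\<exists>e>0. \<forall>s. dist s t < e \<longrightarrow> s \<in> {t. ?E t \<in> S}" by blast
  qed
  then show ?thesis using inG by (simp add: lie_algebra_def continuous_map_def)
qed

text \<open>Von Neumann's argument. As long as \<open>k \<le> e (n + 1)\<close>, the power \<open>A n ^ k\<close> is close to the identity as
  a matrix; being the product of \<open>A n\<close> with the preceding power it stays in the compact
  neighbourhood \<open>K\<close>, and there closeness as a matrix is closeness in \<open>G\<close>, so the induction goes on.
  Hence the limits \<open>exp (t X)\<close> of such powers belong to \<open>K\<close> for small \<open>t\<close>.\<close>

lemma limit_in_lie_algebra:
  assumes lim: "limitin G A (mat 1) sequentially"
    and X: "(\<lambda>n. real (Suc n) *\<^sub>R (A n - mat 1)) \<longlonglongrightarrow> X"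
  shows "X \<in> lie_algebra G"
proof -
  obtain W K where W: "openin G W" "mat 1 \<in> W" "W \<subseteq> K" and K: "compactin G K"
    by (rule compact_neighbourhood)
  have "openin (prod_topology G G) {p \<in> topspace (prod_topology G G). (case p of (A, B) \<Rightarrow> A ** B) \<in> W}"
    by (rule openin_continuous_map_preimage[OF mult_continuous W(1)])
  moreover have "(mat 1, mat 1) \<in> {p \<in> topspace (prod_topology G G). (case p of (A, B) \<Rightarrow> A ** B) \<in> W}"
    using one_in W by simp
  ultimately obtain Wa Wb where Wab: "openin G Wa" "openin G Wb" "mat 1 \<in> Wa" "mat 1 \<in> Wb"
    and prod: "\<And>A B. A \<in> Wa \<Longrightarrow> B \<in> Wb \<Longrightarrow> A ** B \<in> W"
    unfolding openin_prod_topology_alt by (smt (verit, best) mem_Collect_eq mem_Sigma_iff old.prod.case subset_iff)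
  obtain d where d: "0 < d" "\<And>A. A \<in> K \<Longrightarrow> norm (A - mat 1) < d \<Longrightarrow> A \<in> Wb"
    using compact_neighbourhood_detects_identity[OF K Wab(2,4)] by blast
  \<comment> \<open>Comparison with the constant sequence bounds the distance of the powers from the identity.\<close>
  have one: "(\<lambda>n. real (Suc n) *\<^sub>R (mat 1 - mat 1 :: real^'n^'n)) \<longlonglongrightarrow> 0" by simp
  obtain C where "0 \<le> C" and C:
    "\<And>n k t. 0 \<le> t \<Longrightarrow> real k \<le> t * real (Suc n) \<Longrightarrow>
       norm (mpow (A n) k - mpow (mat 1) k) \<le> t * exp (C * t) * (C * norm (real (Suc n) *\<^sub>R (A n - mat 1)))"
    using mpow_sequence_bound[OF X one] by metis
  have mpow_one: "mpow (mat 1 :: real^'n^'n) k = mat 1" for k by (induction k) (simp_all add: mpow_Suc)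
  obtain M where M: "0 < M" "\<And>n. norm (real (Suc n) *\<^sub>R (A n - mat 1)) \<le> M"
    using convergent_imp_Bseq[OF convergentI[OF X]] by (auto simp: Bseq_def simp del: of_nat_Suc)
  \<comment> \<open>On this time interval the bound \<open>e * exp (C * e) * C * M\<close> is smaller than \<open>d\<close>.\<close>
  define e where "e = min 1 (d / (2 * (exp C * (C * M) + 1)))"
  have den: "0 < exp C * (C * M) + 1"
    using \<open>0 \<le> C\<close> M by (intro add_nonneg_pos mult_nonneg_nonneg) auto
  have e: "0 < e" "e \<le> 1" using d(1) den by (auto simp: e_def)
  have close: "norm (mpow (A n) k - mat 1) < d" if "real k \<le> e * real (Suc n)" for n k
  proof -
    have "norm (mpow (A n) k - mat 1) \<le> e * exp (C * e) * (C * norm (real (Suc n) *\<^sub>R (A n - mat 1)))"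
      using C[OF _ that] e by (simp add: mpow_one)
    also have "\<dots> \<le> e * exp (C * 1) * (C * M)"
      using M e \<open>0 \<le> C\<close> by (intro mult_mono mult_left_mono) (auto intro: mult_left_le)
    also have "\<dots> = e * (exp C * (C * M))" by simp
    also have "\<dots> < e * (2 * (exp C * (C * M) + 1))"
    proof -
      have "x < 2 * (x + 1)" if "0 < x + 1" for x :: real using that by simp
      from mult_strict_left_mono[OF this[OF den] e(1)] show ?thesis .
    qed
    also have "\<dots> \<le> d / (2 * (exp C * (C * M) + 1)) * (2 * (exp C * (C * M) + 1))"
      using den unfolding e_def by (intro mult_right_mono) auto
    also have "\<dots> = d" using den by simp
    finally show ?thesis .
  qed
  have ev: "\<forall>\<^sub>F n in sequentially. A n \<in> Wa" using lim Wab by (auto simp: limitin_def)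
  have powK: "mpow (A n) k \<in> K \<inter> Wb" if "A n \<in> Wa" "real k \<le> e * real (Suc n)" for n k
    using that(2)
  proof (induction k)
    case (Suc k)
    then have "mpow (A n) k \<in> Wb" by auto
    then have "mpow (A n) (Suc k) \<in> K" using prod that(1) W(3) by (auto simp: mpow_Suc)
    with close[OF Suc.prems] d(2) show ?case by auto
  qed (use W Wab in auto)
  have EK: "matrix_exp (t *\<^sub>R X) \<in> K" if t: "0 \<le> t" "t \<le> e" for t
  proof (rule Lim_in_closed_set[OF _ _ _ mpow_limit[OF X t(1)]])
    show "closed K" using K by (intro compact_imp_closed compact_in_matrices)
    show "\<forall>\<^sub>F n in sequentially. mpow (A n) (nat \<lfloor>t * real (Suc n)\<rfloor>) \<in> K"
      using ev
    proof eventually_elim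
      case (elim n)
      have "real (nat \<lfloor>t * real (Suc n)\<rfloor>) \<le> t * real (Suc n)" using t by simp
      also have "\<dots> \<le> e * real (Suc n)" using t by (intro mult_right_mono) auto
      finally show ?case using powK[OF elim] by blast
    qed
  qed simp
  show ?thesis
  proof (rule one_parameter_in_lie_algebra)
    fix S assume "openin G S" "mat 1 \<in> S"
    then obtain d' where d': "0 < d'" "\<And>A. A \<in> K \<Longrightarrow> norm (A - mat 1) < d' \<Longrightarrow> A \<in> S"
      using compact_neighbourhood_detects_identity[OF K] by blast
    have "isCont (\<lambda>s. matrix_exp (s *\<^sub>R X)) 0"
      by (rule has_vector_derivative_continuous[OF matrix_exp_has_vector_derivative])
    then obtain r where r: "r > 0" "\<And>s. norm s < r \<Longrightarrow> norm (matrix_exp (s *\<^sub>R X) - mat 1) < d'"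
      using d'(1) by (fastforce simp: continuous_at_eps_delta dist_norm)
    show "\<exists>d>0. \<forall>s. 0 \<le> s \<and> s < d \<longrightarrow> matrix_exp (s *\<^sub>R X) \<in> S"
      using e r by (intro exI[of _ "min e r"]) (auto intro!: d'(2) EK)
  qed
qed

section \<open>The Lie algebra\<close>

lemma lie_algebra_exp_in: "X \<in> lie_algebra G \<Longrightarrow> matrix_exp (t *\<^sub>R X) \<in> topspace G"
  by (auto simp: lie_algebra_def continuous_map_def Pi_iff)

lemma limitin_matrix_exp:
  assumes "X \<in> lie_algebra G"
  shows "limitin G (\<lambda>n. matrix_exp ((1 / real (Suc n)) *\<^sub>R X)) (mat 1) sequentially"
proof -
  have "limitin euclideanreal (\<lambda>n. 1 / real (Suc n)) 0 sequentially"
    using LIMSEQ_inverse_real_of_nat by (simp add: inverse_eq_divide)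
  moreover have "continuous_map euclideanreal G (\<lambda>t. matrix_exp (t *\<^sub>R X))"
    using assms by (simp add: lie_algebra_def)
  ultimately show ?thesis by (auto dest!: continuous_map_limit simp: o_def)
qed

lemma matrix_exp_sequence: "(\<lambda>n. real (Suc n) *\<^sub>R (matrix_exp ((1 / real (Suc n)) *\<^sub>R X) - mat 1)) \<longlonglongrightarrow> X"
  using vector_derivative_imp_sequence[OF matrix_exp_has_vector_derivative[of X 0]] by simp

text \<open>For sums, \<open>exp (X / n) exp (Y / n)\<close> is a sequence in \<open>G\<close> to which von Neumann's argument applies.\<close>

lemma subspace_lie_algebra: "subspace (lie_algebra G)"
  unfolding subspace_def
proof (intro conjI ballI allI)
  show "0 \<in> lie_algebra G" using one_in by (simp add: lie_algebra_def)
next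
  fix X and c :: real assume "X \<in> lie_algebra G"
  then have "continuous_map euclideanreal G ((\<lambda>t. matrix_exp (t *\<^sub>R X)) \<circ> (\<lambda>t. t * c))"
    by (intro continuous_map_compose[of _ euclideanreal])
       (auto simp: lie_algebra_def intro!: continuous_intros)
  then show "c *\<^sub>R X \<in> lie_algebra G" by (simp add: lie_algebra_def o_def)
next
  fix X Y assume XY: "X \<in> lie_algebra G" "Y \<in> lie_algebra G"
  let ?P = "\<lambda>t. matrix_exp (t *\<^sub>R X) ** matrix_exp (t *\<^sub>R Y)"
  have "(?P has_vector_derivative (Y + X)) (at 0)"
    using mm.has_vector_derivative[OF matrix_exp_has_vector_derivative matrix_exp_has_vector_derivative, of X Y 0]
    by simp
  from vector_derivative_imp_sequence[OF this]
  have "(\<lambda>n. real (Suc n) *\<^sub>R (?P (1 / real (Suc n)) - mat 1)) \<longlonglongrightarrow> X + Y" by (simp add: add.commute)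
  moreover have "limitin G (\<lambda>n. ?P (1 / real (Suc n))) (mat 1) sequentially"
    using limitin_mult[OF XY[THEN limitin_matrix_exp]] by simp
  ultimately show "X + Y \<in> lie_algebra G" by (intro limit_in_lie_algebra)
qed

lemma lie_algebra_Ad:
  assumes "A \<in> topspace G" "X \<in> lie_algebra G"
  shows "A ** X ** matrix_inv A \<in> lie_algebra G"
proof -
  have "continuous_map euclideanreal G (\<lambda>t. A ** matrix_exp (t *\<^sub>R X) ** matrix_inv A)"
    using assms by (intro continuous_map_mult) (auto simp: lie_algebra_def inv_in)
  then show ?thesis
    by (simp add: lie_algebra_def matrix_exp_conjugate inv_mult assms)
qed

text \<open>The bracket is the derivative at zero of a curve in the Lie algebra, which is a closed set as a
  subspace of finite dimension.\<close>

lemma lie_algebra_bracket: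
  assumes X: "X \<in> lie_algebra G" and Y: "Y \<in> lie_algebra G"
  shows "X ** Y - Y ** X \<in> lie_algebra G"
proof -
  let ?F = "\<lambda>t. matrix_exp (t *\<^sub>R X) ** Y ** matrix_exp (- (t *\<^sub>R X))"
  have F: "?F t \<in> lie_algebra G" for t
  proof -
    have "matrix_inv (matrix_exp (t *\<^sub>R X)) = matrix_exp (- (t *\<^sub>R X))"
      by (intro matrix_inv_unique_left matrix_exp_inverse)
    then show ?thesis using lie_algebra_Ad[OF lie_algebra_exp_in[OF X, of t] Y] by simp
  qed
  have "(?F has_vector_derivative (X ** Y - Y ** X)) (at 0)"
    using mm.has_vector_derivative[OF mm.has_vector_derivative[OF matrix_exp_has_vector_derivative[of X]
      has_vector_derivative_const[of Y]] matrix_exp_neg_has_vector_derivative[of X], of 0]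
    by (simp add: mm.minus_right)
  from vector_derivative_imp_sequence[OF this]
  have "(\<lambda>n. real (Suc n) *\<^sub>R (?F (1 / real (Suc n)) - ?F 0)) \<longlonglongrightarrow> X ** Y - Y ** X" by simp
  then show ?thesis
    by (rule Lim_in_closed_set[OF closed_subspace[OF subspace_lie_algebra] always_eventually, rotated -1])
       (use F F[of 0] in \<open>auto intro!: subspace_scale subspace_diff subspace_lie_algebra\<close>)
qed

lemma lie_algebra_apply_sequence:
  "(\<lambda>n. real (Suc n) *\<^sub>R (matrix_exp ((1 / real (Suc n)) *\<^sub>R X) *v w - w)) \<longlonglongrightarrow> X *v w"
proof -
  have "(\<lambda>n. (real (Suc n) *\<^sub>R (matrix_exp ((1 / real (Suc n)) *\<^sub>R X) - mat 1)) *v w) \<longlonglongrightarrow> X *v w"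
    by (intro mv.tendsto tendsto_const matrix_exp_sequence)
  then show ?thesis by (simp add: mv.scaleR_left mv.diff_left del: of_nat_Suc)
qed

lemma lie_algebra_preserves:
  assumes X: "X \<in> lie_algebra G" and L: "subspace L" and inv: "\<And>A w. A \<in> topspace G \<Longrightarrow> w \<in> L \<Longrightarrow> A *v w \<in> L"
    and w: "w \<in> L"
  shows "X *v w \<in> L"
proof (rule Lim_in_closed_set[OF closed_subspace[OF L] always_eventually _ lie_algebra_apply_sequence])
  show "\<forall>n. real (Suc n) *\<^sub>R (matrix_exp ((1 / real (Suc n)) *\<^sub>R X) *v w - w) \<in> L"
    by (intro allI subspace_scale[OF L] subspace_diff[OF L] inv[OF lie_algebra_exp_in[OF X] w] w)
qed simp

text \<open>This replaces the identification of the Lie algebra with a tangent space: differentiability of one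
  curve in \<open>G\<close> at one point is enough.\<close>

lemma right_log_derivative_in_lie_algebra:
  assumes der: "(\<gamma> has_vector_derivative D) (at t)" and lim: "limitin G \<gamma> (\<gamma> t) (at t)"
  shows "D ** matrix_inv (\<gamma> t) \<in> lie_algebra G"
proof (rule limit_in_lie_algebra)
  have in_G: "\<gamma> t \<in> topspace G" using lim by (simp add: limitin_def)
  have "filterlim (\<lambda>n. 1 / real (Suc n)) (at 0) sequentially"
    using LIMSEQ_inverse_real_of_nat by (simp add: filterlim_at inverse_eq_divide)
  then have "filterlim (\<lambda>n. t + 1 / real (Suc n)) (at t) sequentially"
    using LIMSEQ_inverse_real_of_nat tendsto_add[OF tendsto_const[of t]]
    by (auto simp: filterlim_at inverse_eq_divide intro: tendsto_eq_intros)
  then have "limitin G (\<lambda>n. \<gamma> (t + 1 / real (Suc n))) (\<gamma> t) sequentially"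
    using lim unfolding limitin_def filterlim_iff by blast
  moreover have "limitin G (\<lambda>n. matrix_inv (\<gamma> t)) (matrix_inv (\<gamma> t)) sequentially"
    using inv_in[OF in_G] by (simp add: limitin_def)
  ultimately have "limitin G (\<lambda>n. \<gamma> (t + 1 / real (Suc n)) ** matrix_inv (\<gamma> t)) (\<gamma> t ** matrix_inv (\<gamma> t)) sequentially"
    by (rule limitin_mult)
  then show "limitin G (\<lambda>n. \<gamma> (t + 1 / real (Suc n)) ** matrix_inv (\<gamma> t)) (mat 1) sequentially"
    by (simp only: inv_mult(1)[OF in_G])
  have "(\<lambda>n. (real (Suc n) *\<^sub>R (\<gamma> (t + 1 / real (Suc n)) - \<gamma> t)) ** matrix_inv (\<gamma> t)) \<longlonglongrightarrow> D ** matrix_inv (\<gamma> t)"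
    by (intro mm.tendsto tendsto_const vector_derivative_imp_sequence der)
  then show "(\<lambda>n. real (Suc n) *\<^sub>R (\<gamma> (t + 1 / real (Suc n)) ** matrix_inv (\<gamma> t) - mat 1)) \<longlonglongrightarrow> D ** matrix_inv (\<gamma> t)"
    by (simp add: mm.scaleR_left mm.diff_left inv_mult(1)[OF in_G] del: of_nat_Suc)
qed

end

section \<open>Invariance under the Lie algebra and under the group\<close>

lemma linear_gronwall_zero:
  fixes z :: "real \<Rightarrow> 'a::real_inner"
  assumes der: "\<And>t. 0 \<le> t \<Longrightarrow> t \<le> 1 \<Longrightarrow> (z has_vector_derivative z' t) (at t)"
    and bound: "\<And>t. 0 \<le> t \<Longrightarrow> t \<le> 1 \<Longrightarrow> norm (z' t) \<le> C * norm (z t)"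
    and "z 0 = 0"
  shows "z 1 = 0"
proof -
  let ?q = "\<lambda>t. exp (- (2 * C) * t) * (z t \<bullet> z t)"
  have "?q 1 \<le> ?q 0"
  proof (rule DERIV_nonpos_imp_nonincreasing[where f = ?q])
    fix t :: real assume t: "0 \<le> t" "t \<le> 1"
    have "((\<lambda>t. z t \<bullet> z t) has_vector_derivative (z t \<bullet> z' t + z' t \<bullet> z t)) (at t)"
      by (rule bounded_bilinear.has_vector_derivative[OF bounded_bilinear_inner der[OF t] der[OF t]])
    then have "((\<lambda>t. z t \<bullet> z t) has_real_derivative 2 * (z t \<bullet> z' t)) (at t)"
      by (simp add: has_real_derivative_iff_has_vector_derivative inner_commute)
    then have d: "(?q has_real_derivative (exp (- (2 * C) * t) * (- (2 * C)) * (z t \<bullet> z t) + exp (- (2 * C) * t) * (2 * (z t \<bullet> z' t)))) (at t)"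
      by (auto intro!: derivative_eq_intros)
    have "z t \<bullet> z' t \<le> norm (z t) * norm (z' t)" by (rule norm_cauchy_schwarz)
    also have "\<dots> \<le> norm (z t) * (C * norm (z t))" by (intro mult_left_mono bound t) auto
    also have "\<dots> = C * (z t \<bullet> z t)" by (simp add: dot_square_norm power2_eq_square)
    finally have "exp (- (2 * C) * t) * (2 * (z t \<bullet> z' t) - 2 * (C * (z t \<bullet> z t))) \<le> 0"
      by (intro mult_nonneg_nonpos) auto
    then show "\<exists>y. (?q has_real_derivative y) (at t) \<and> y \<le> 0"
      using d by (intro exI conjI) (assumption, simp add: algebra_simps)
  qed simp
  then have "z 1 \<bullet> z 1 \<le> 0" using assms(3) by (simp add: mult_le_0_iff)
  then show ?thesis by (metis inner_eq_zero_iff inner_ge_zero order_antisym)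
qed

context matrix_lie_group begin

text \<open>A point of a chart is joined to the identity by the image \<open>\<gamma>\<close> of a segment, with \<open>\<gamma>' = \<xi> \<gamma>\<close> and \<open>\<xi>(t)\<close> in
  the Lie algebra. As \<open>\<xi>\<close> preserves \<open>L\<close>, the component of \<open>\<gamma>(t) w\<close> transverse to \<open>L\<close> solves a linear
  differential inequality with initial value zero.\<close>

lemma invariant_near_identity:
  assumes L: "subspace L" and inv: "\<And>X w. X \<in> lie_algebra G \<Longrightarrow> w \<in> L \<Longrightarrow> X *v w \<in> L"
  obtains W where "openin G W" "mat 1 \<in> W" "\<And>A w. A \<in> W \<Longrightarrow> w \<in> L \<Longrightarrow> A *v w \<in> L"
proof -
  obtain V :: "(real^'n^'n) set" and u e \<phi> where V: "subspace V" and u: "u \<in> V" "0 < e" "\<phi> u = mat 1"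
    and W: "openin G (\<phi> ` (ball u e \<inter> V))" and cont: "continuous_map (top_of_set (ball u e \<inter> V)) G \<phi>"
    and Ck: "\<And>k. Ck_on k V (ball u e \<inter> V) \<phi>"
    using identity_chart by metis
  let ?B = "ball u e \<inter> V"
  have "A *v w \<in> L" if A: "A \<in> \<phi> ` ?B" and w: "w \<in> L" for A w
  proof -
    obtain x where x: "x \<in> ?B" "A = \<phi> x" using A by auto
    define v where "v = x - u"
    have v: "v \<in> V" using x u V by (auto simp: v_def intro: subspace_diff)
    obtain \<phi>' where \<phi>': "\<And>y. y \<in> ?B \<Longrightarrow> ((\<lambda>t. \<phi> (y + t *\<^sub>R v)) has_vector_derivative \<phi>' y) (at 0)"
      "continuous_on ?B \<phi>'"
      using Ck[of "Suc 0"] v unfolding Ck_on.simps by metis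
    define l where "l t = u + t *\<^sub>R v" for t :: real
    define \<gamma> where "\<gamma> t = \<phi> (l t)" for t
    have lB: "l t \<in> ?B" if "0 \<le> t" "t \<le> 1" for t
    proof -
      have "norm (t *\<^sub>R v) \<le> norm v" using that by (simp add: mult_left_le_one_le)
      moreover have "norm v < e" using x by (auto simp: v_def dist_norm norm_minus_commute)
      ultimately show ?thesis
        using u V v by (auto simp: l_def dist_norm intro: subspace_add subspace_scale)
    qed
    have lcont: "continuous (at t) l" for t unfolding l_def by (intro continuous_intros)
    have der: "(\<gamma> has_vector_derivative \<phi>' (l t)) (at t)" if "0 \<le> t" "t \<le> 1" for t
    proof -
      have "((\<lambda>s. s - t) has_vector_derivative 1) (at t)"
        by (simp add: has_vector_derivative_diff_const)
      moreover have "((\<lambda>s. \<phi> (l t + s *\<^sub>R v)) has_vector_derivative \<phi>' (l t)) (at (t - t))"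
        using \<phi>'(1)[OF lB[OF that]] by simp
      ultimately have "((\<lambda>s. \<phi> (l t + s *\<^sub>R v)) \<circ> (\<lambda>s. s - t) has_vector_derivative 1 *\<^sub>R \<phi>' (l t)) (at t)"
        by (rule vector_diff_chain_at)
      moreover have "(\<lambda>s. \<phi> (l t + s *\<^sub>R v)) \<circ> (\<lambda>s. s - t) = \<gamma>"
        by (auto simp: \<gamma>_def l_def algebra_simps)
      ultimately show ?thesis by simp
    qed
    have lim: "limitin G \<gamma> (\<gamma> t) (at t)" if t: "0 \<le> t" "t \<le> 1" for t
    proof -
      have "l s \<in> V" for s using u V v by (auto simp: l_def intro: subspace_add subspace_scale)
      moreover have "\<forall>\<^sub>F s in at t. l s \<in> ball u e"
        using lcont[of t] lB[OF t] topological_tendstoD[of l "l t" "at t" "ball u e"]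
        by (simp add: isCont_def)
      ultimately have "limitin (top_of_set ?B) l (l t) (at t)"
        using lcont[of t] lB[OF t] by (simp add: limitin_subtopology isCont_def)
      from continuous_map_limit[OF cont this] show ?thesis by (simp add: \<gamma>_def[abs_def] o_def)
    qed
    have \<gamma>G: "\<gamma> t \<in> topspace G" if "0 \<le> t" "t \<le> 1" for t
      using limitin_topspace[OF lim[OF that]] .
    define \<xi> where "\<xi> t = \<phi>' (l t) ** matrix_inv (\<gamma> t)" for t
    have \<xi>: "\<xi> t \<in> lie_algebra G" if "0 \<le> t" "t \<le> 1" for t
      unfolding \<xi>_def by (intro right_log_derivative_in_lie_algebra der lim that)
    have "continuous_on {0..1} \<xi>"
    proof -
      have c1: "continuous_on {0..1} l" using lcont by (simp add: continuous_at_imp_continuous_on)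
      have c2: "continuous_on {0..1} (\<lambda>t. \<phi>' (l t))"
        by (rule continuous_on_compose2[OF \<phi>'(2) c1]) (use lB in auto)
      have "continuous_map (top_of_set {0..1}) (top_of_set ?B) l"
        using c1 lB by auto
      from continuous_map_compose[OF continuous_map_compose[OF continuous_map_compose[OF this cont] inv_continuous] inclusion_continuous]
      have "continuous_on {0..1} (\<lambda>t. matrix_inv (\<gamma> t))" by (simp add: o_def \<gamma>_def)
      with c2 show ?thesis unfolding \<xi>_def by (intro mm.continuous_on)
    qed
    then have "compact (\<xi> ` {0..1})" by (intro compact_continuous_image) auto
    then have "bounded (\<xi> ` {0..1})" by (rule compact_imp_bounded)
    then obtain M where M: "\<And>t. 0 \<le> t \<Longrightarrow> t \<le> 1 \<Longrightarrow> norm (\<xi> t) \<le> M"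
      unfolding bounded_iff by (metis atLeastAtMost_iff imageI)
    obtain K where K: "\<And>A w. norm ((A::real^'n^'n) *v w) \<le> norm A * norm w * K" "0 \<le> K"
      using mv.nonneg_bounded by (elim exE conjE) blast
    \<comment> \<open>\<open>\<pi>\<close> is a projection with kernel \<open>L\<close>.\<close>
    obtain p where p: "range p \<subseteq> L" "linear p" "\<And>w. w \<in> L \<Longrightarrow> p w = w"
      using linear_exists_left_inverse_on[OF linear_id L] by auto
    have pL: "p w \<in> L" for w using p(1) by auto
    define \<pi> where "\<pi> w = w - p w" for w
    have "linear \<pi>" unfolding \<pi>_def by (intro linear_compose_sub linear_ident p)
    then have \<pi>: "bounded_linear \<pi>" by (rule linear_conv_bounded_linear[THEN iffD1])
    then obtain P where P: "\<And>w. norm (\<pi> w) \<le> norm w * P" "0 \<le> P"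
      using bounded_linear.nonneg_bounded by blast
    have \<pi>L: "\<pi> w = 0 \<longleftrightarrow> w \<in> L" for w using p(3) pL[of w] by (auto simp: \<pi>_def)
    have \<pi>\<pi>: "\<pi> (X *v w) = \<pi> (X *v \<pi> w)" if "X \<in> lie_algebra G" for X w
    proof -
      have "\<pi> (X *v p w) = 0" using inv[OF that pL] by (simp add: \<pi>L)
      moreover have "X *v w = X *v p w + X *v \<pi> w" by (simp add: \<pi>_def mv.diff_right)
      ultimately show ?thesis using linear_add[OF \<open>linear \<pi>\<close>] by simp
    qed
    have "\<pi> (\<gamma> 1 *v w) = 0"
    proof (rule linear_gronwall_zero)
      fix t :: real assume t: "0 \<le> t" "t \<le> 1"
      have "((\<lambda>t. \<gamma> t *v w) has_vector_derivative \<phi>' (l t) *v w) (at t)"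
        using mv.has_vector_derivative[OF der[OF t] has_vector_derivative_const[of w]] by simp
      then show "((\<lambda>t. \<pi> (\<gamma> t *v w)) has_vector_derivative \<pi> (\<phi>' (l t) *v w)) (at t)"
        by (rule bounded_linear.has_vector_derivative[OF \<pi>])
      have "\<phi>' (l t) = \<xi> t ** \<gamma> t"
        using inv_mult(2)[OF \<gamma>G[OF t]] by (simp add: \<xi>_def flip: matrix_mul_assoc)
      then have "\<pi> (\<phi>' (l t) *v w) = \<pi> (\<xi> t *v \<pi> (\<gamma> t *v w))"
        using \<pi>\<pi>[OF \<xi>[OF t]] by (simp flip: matrix_vector_mul_assoc)
      also have "norm \<dots> \<le> norm (\<xi> t *v \<pi> (\<gamma> t *v w)) * P" by (rule P)
      also have "\<dots> \<le> norm (\<xi> t) * norm (\<pi> (\<gamma> t *v w)) * K * P" by (intro mult_right_mono K P)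
      also have "\<dots> \<le> M * norm (\<pi> (\<gamma> t *v w)) * K * P"
        using K(2) P(2) by (intro mult_right_mono M t) auto
      finally show "norm (\<pi> (\<phi>' (l t) *v w)) \<le> (M * K * P) * norm (\<pi> (\<gamma> t *v w))"
        by (simp add: mult_ac)
    next
      show "\<pi> (\<gamma> 0 *v w) = 0" using w u(3) by (simp add: \<gamma>_def l_def \<pi>L)
    qed
    then show ?thesis by (simp add: \<pi>L x \<gamma>_def l_def v_def)
  qed
  moreover have "mat 1 \<in> \<phi> ` ?B" using u by (metis IntI centre_in_ball image_eqI)
  ultimately show thesis using W that by blast
qed

text \<open>The stabilizer of \<open>L\<close> contains a neighbourhood of the identity, so it is an open subgroup, and its
  cosets are open as well.\<close>

lemma lie_algebra_invariant_imp_invariant: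
  assumes conn: "connected_space G" and L: "subspace L"
    and inv: "\<And>X w. X \<in> lie_algebra G \<Longrightarrow> w \<in> L \<Longrightarrow> X *v w \<in> L"
    and A: "A \<in> topspace G"
  shows "(\<lambda>w. A *v w) ` L = L"
proof -
  obtain W where W: "openin G W" "mat 1 \<in> W" "\<And>A w. A \<in> W \<Longrightarrow> w \<in> L \<Longrightarrow> A *v w \<in> L"
    using invariant_near_identity[OF L inv] by blast
  define H where "H = {A \<in> topspace G. \<forall>w\<in>L. A *v w \<in> L}"
  have im: "(\<lambda>w. A *v w) ` L = L" if "A \<in> H" for A
  proof (rule subspace_dim_equal)
    have "inj ((*v) A)" using that invertible[of A] by (simp add: H_def inj_matrix_vector_mult)
    then have "dim ((\<lambda>w. A *v w) ` L) = dim L"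
      by (intro dim_image_eq) (simp_all add: inj_on_subset[of _ UNIV])
    then show "dim L \<le> dim ((\<lambda>w. A *v w) ` L)" by simp
    show "subspace ((\<lambda>w. A *v w) ` L)" by (intro linear_subspace_image L) simp
    show "(\<lambda>w. A *v w) ` L \<subseteq> L" using that by (auto simp: H_def)
  qed (fact L)
  have inv_H: "matrix_inv A \<in> H" if "A \<in> H" for A
  proof -
    have AG: "A \<in> topspace G" using that by (simp add: H_def)
    have "matrix_inv A *v w \<in> L" if "w \<in> L" for w
    proof -
      have "w \<in> (\<lambda>w. A *v w) ` L" using im[OF \<open>A \<in> H\<close>] that by simp
      then obtain w' where w': "w' \<in> L" "w = A *v w'" by auto
      then have "matrix_inv A *v w = w'"
        using matrix_vector_mul_assoc[of "matrix_inv A" A w'] inv_mult(2)[OF AG] by simp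
      with w' show ?thesis by simp
    qed
    then show ?thesis using AG by (simp add: H_def inv_in)
  qed
  have mult_H: "A ** B \<in> H" if "A \<in> H" "B \<in> H" for A B
    using that by (auto simp: H_def mult_in simp flip: matrix_vector_mul_assoc)
  have WH: "W \<subseteq> H" using W openin_subset[OF W(1)] by (auto simp: H_def)
  have coset: "\<exists>T. openin G T \<and> A \<in> T \<and> (\<forall>B\<in>T. matrix_inv A ** B \<in> H)" if "A \<in> topspace G" for A
    using left_mult_open[OF inv_in[OF that] W(1)] that W(2) WH
    by (intro exI[of _ "{B \<in> topspace G. matrix_inv A ** B \<in> W}"]) (auto simp: inv_mult)
  have "openin G H"
  proof (subst openin_subopen, intro ballI)
    fix A assume A: "A \<in> H"
    then have AG: "A \<in> topspace G" by (simp add: H_def)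
    obtain T where T: "openin G T" "A \<in> T" "\<And>B. B \<in> T \<Longrightarrow> matrix_inv A ** B \<in> H"
      using coset[OF AG] by blast
    have "B \<in> H" if "B \<in> T" for B
      using mult_H[OF A T(3)[OF that]] by (simp add: matrix_mul_assoc inv_mult[OF AG])
    then show "\<exists>T. openin G T \<and> A \<in> T \<and> T \<subseteq> H" using T by blast
  qed
  moreover have "openin G (topspace G - H)"
  proof (subst openin_subopen, intro ballI)
    fix A assume A: "A \<in> topspace G - H"
    then obtain T where T: "openin G T" "A \<in> T" "\<And>B. B \<in> T \<Longrightarrow> matrix_inv A ** B \<in> H"
      using coset[of A] by blast
    have "B \<notin> H" if B: "B \<in> T" for B
    proof
      assume "B \<in> H"
      have BG: "B \<in> topspace G" using \<open>B \<in> H\<close> by (simp add: H_def)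
      let ?C = "matrix_inv A ** B"
      have C: "?C \<in> H" by (rule T(3)[OF B])
      then have CG: "?C \<in> topspace G" by (simp add: H_def)
      have "A ** ?C = B" using A by (simp add: matrix_mul_assoc inv_mult)
      then have "B ** matrix_inv ?C = A ** (?C ** matrix_inv ?C)" by (simp add: matrix_mul_assoc)
      also have "\<dots> = A" using inv_mult(1)[OF CG] by simp
      finally show False using mult_H[OF \<open>B \<in> H\<close> inv_H[OF C]] A by simp
    qed
    then show "\<exists>T. openin G T \<and> A \<in> T \<and> T \<subseteq> topspace G - H" using T openin_subset by blast
  qed
  ultimately have "H = topspace G"
    using conn W(2) WH openin_subset[of G H] unfolding connected_space_clopen_in closedin_def
    by (metis empty_iff subset_iff)
  then show ?thesis using A im by simp
qed

text \<open>If \<open>X v = c v\<close>, then \<open>exp (t X) v = exp (c t) v\<close> by uniqueness for linear differential equations.\<close>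

lemma lie_algebra_stabilizer:
  "lie_algebra (stabilizer G (span {v})) = {X \<in> lie_algebra G. X *v v \<in> span {v}}"
proof -
  have "(X \<in> lie_algebra (stabilizer G (span {v}))) \<longleftrightarrow> X *v v \<in> span {v}" if X: "X \<in> lie_algebra G" for X
  proof -
    have "(X \<in> lie_algebra (stabilizer G (span {v}))) \<longleftrightarrow>
        (\<forall>t. (\<lambda>w. matrix_exp (t *\<^sub>R X) *v w) ` span {v} = span {v})"
      using X by (auto simp: lie_algebra_def stabilizer_def continuous_map_in_subtopology)
    also have "\<dots> \<longleftrightarrow> X *v v \<in> span {v}"
    proof
      assume *: "\<forall>t. (\<lambda>w. matrix_exp (t *\<^sub>R X) *v w) ` span {v} = span {v}"
      have "matrix_exp (t *\<^sub>R X) *v v \<in> span {v}" for t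
        using *[rule_format, of t] span_base[of v "{v}"] by blast
      then show "X *v v \<in> span {v}"
        by (intro Lim_in_closed_set[OF closed_subspace[OF subspace_span] always_eventually _ lie_algebra_apply_sequence])
           (auto intro!: span_scale span_diff intro: span_base)
    next
      assume "X *v v \<in> span {v}"
      then obtain c where c: "X *v v = c *\<^sub>R v" by (auto simp: span_singleton)
      have ev: "matrix_exp (t *\<^sub>R X) *v v = exp (c * t) *\<^sub>R v" for t
      proof -
        have "((\<lambda>t. matrix_exp (- (t *\<^sub>R X)) *v (exp (c * t) *\<^sub>R v)) has_vector_derivative 0) (at s)" for s
        proof -
          have e: "((\<lambda>t. exp (c * t) *\<^sub>R v) has_vector_derivative (c * exp (c * s)) *\<^sub>R v) (at s)"
            by (auto intro!: derivative_eq_intros simp: has_vector_derivative_def mult_ac)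
          show ?thesis
            using mv.has_vector_derivative[OF matrix_exp_neg_has_vector_derivative e, of X]
            by (simp add: mv.minus_left mv.scaleR_right c mult.commute flip: matrix_vector_mul_assoc)
        qed
        from constant_if_vector_derivative_zero[OF this, of t 0]
        have "matrix_exp (- (t *\<^sub>R X)) *v (exp (c * t) *\<^sub>R v) = v" by simp
        then have "matrix_exp (t *\<^sub>R X) *v v
            = (matrix_exp (t *\<^sub>R X) ** matrix_exp (- (t *\<^sub>R X))) *v (exp (c * t) *\<^sub>R v)"
          by (simp flip: matrix_vector_mul_assoc)
        then show ?thesis by (simp add: matrix_exp_inverse)
      qed
      show "\<forall>t. (\<lambda>w. matrix_exp (t *\<^sub>R X) *v w) ` span {v} = span {v}"
      proof
        fix t
        have "(\<lambda>w. matrix_exp (t *\<^sub>R X) *v w) ` span {v} = span ((\<lambda>w. matrix_exp (t *\<^sub>R X) *v w) ` {v})"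
          by (rule linear_span_image[symmetric]) simp
        also have "\<dots> = span {v}"
          using span_image_scale[of "{v}" "\<lambda>_. exp (c * t)"] by (simp add: ev)
        finally show "(\<lambda>w. matrix_exp (t *\<^sub>R X) *v w) ` span {v} = span {v}" .
      qed
    qed
    finally show ?thesis .
  qed
  moreover have "lie_algebra (stabilizer G (span {v})) \<subseteq> lie_algebra G"
    by (auto simp: lie_algebra_def stabilizer_def continuous_map_in_subtopology)
  ultimately show ?thesis by blast
qed

end

section \<open>The bilinear form of signature (2,3)\<close>

lemma exhaust_5:
  fixes x :: 5
  shows "x = 1 \<or> x = 2 \<or> x = 3 \<or> x = 4 \<or> x = 5"
proof (induct x)
  case (of_int z)
  then have "0 \<le> z" and "z < 5" by simp_all
  then have "z = 0 \<or> z = 1 \<or> z = 2 \<or> z = 3 \<or> z = 4" by arith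
  then show ?case by auto
qed

lemma UNIV_5: "UNIV = {1, 2, 3, 4, 5 :: 5}"
  using exhaust_5 by auto

lemma forall_5: "(\<forall>i::5. P i) \<longleftrightarrow> P 1 \<and> P 2 \<and> P 3 \<and> P 4 \<and> P 5"
proof -
  have "(\<forall>i\<in>(UNIV :: 5 set). P i) \<longleftrightarrow> P 1 \<and> P 2 \<and> P 3 \<and> P 4 \<and> P 5"
    unfolding UNIV_5 by simp
  then show ?thesis by simp
qed

lemma sum_5: "sum f (UNIV :: 5 set) = f 1 + f 2 + f 3 + f 4 + f 5"
  unfolding UNIV_5 by (simp add: ac_simps)

definition bform :: "real^5 \<Rightarrow> real^5 \<Rightarrow> real" where
  "bform x y = - x$1 * y$1 - x$2 * y$2 + x$3 * y$3 + x$4 * y$4 + x$5 * y$5"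

lemma bounded_bilinear_bform: "bounded_bilinear bform"
proof -
  have "bilinear bform"
    unfolding bilinear_def linear_iff by (auto simp: bform_def algebra_simps)
  then show ?thesis by (simp add: bilinear_conv_bounded_bilinear)
qed

interpretation bf: bounded_bilinear bform
  by (rule bounded_bilinear_bform)

lemma bform_commute: "bform x y = bform y x"
  by (simp add: bform_def mult.commute)

lemma bform_self: "bform x x = qform x"
  by (simp add: bform_def qform_def power2_eq_square)

lemma qform_add: "qform (x + y) = qform x + 2 * bform x y + qform y"
  by (simp add: bform_commute[of y x] bf.add_left bf.add_right flip: bform_self)

definition perp :: "(real^5) set \<Rightarrow> (real^5) set" where
  "perp S = {x. \<forall>y\<in>S. bform x y = 0}"

lemma subspace_perp: "subspace (perp S)"
  by (auto simp: subspace_def perp_def bf.zero_left bf.add_left bf.scaleR_left)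

lemma perp_span: "perp (span S) = perp S"
proof (intro equalityI subsetI)
  fix x assume x: "x \<in> perp S"
  have "S \<subseteq> {y. bform x y = 0}" using x by (auto simp: perp_def)
  moreover have "subspace {y. bform x y = 0}"
    by (auto simp: subspace_def bf.zero_right bf.add_right bf.scaleR_right)
  ultimately have "span S \<subseteq> {y. bform x y = 0}" by (rule span_minimal)
  then show "x \<in> perp (span S)" by (auto simp: perp_def)
next
  fix x assume "x \<in> perp (span S)"
  then show "x \<in> perp S" using span_superset[of S] by (auto simp: perp_def)
qed

text \<open>The form is the Euclidean inner product composed with the reflection \<open>f\<close> in the two negative
  coordinates, so \<open>perp S\<close> is the Euclidean orthogonal complement of \<open>f ` S\<close>.\<close>

lemma dim_perp:
  assumes "subspace S"
  shows "dim (perp S) + dim S = 5"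
proof -
  define f :: "real^5 \<Rightarrow> real^5" where "f y = (\<chi> i. if i = 1 \<or> i = 2 then - y $ i else y $ i)" for y
  have lin: "linear f" by (simp add: linear_iff f_def vec_eq_iff)
  have inner: "f y \<bullet> x = bform x y" for x y
    by (simp add: inner_vec_def sum_5 f_def bform_def algebra_simps)
  have "f (f y) = y" for y by (simp add: f_def vec_eq_iff)
  then have inj: "inj f" by (metis injI)
  have "dim {y \<in> UNIV. \<forall>x \<in> f ` S. orthogonal x y} + dim (f ` S) = dim (UNIV :: (real^5) set)"
    by (rule dim_subspace_orthogonal_to_vectors) (use assms lin in \<open>auto intro: linear_subspace_image\<close>)
  moreover have "{y \<in> UNIV. \<forall>x \<in> f ` S. orthogonal x y} = perp S"
    by (auto simp: orthogonal_def inner perp_def)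
  moreover have "dim (f ` S) = dim S"
    by (rule dim_image_eq[OF lin]) (auto intro: inj_on_subset[OF inj])
  ultimately show ?thesis by simp
qed

section \<open>Dimension counts\<close>

lemma dim_kernel_image:
  fixes f :: "'a::euclidean_space \<Rightarrow> 'b::euclidean_space"
  assumes lin: "linear f" and S: "subspace S"
  shows "dim {x \<in> S. f x = 0} + dim (f ` S) = dim S"
proof -
  let ?K = "{x \<in> S. f x = 0}"
  let ?C = "{y \<in> S. \<forall>x\<in>?K. orthogonal x y}"
  have K: "subspace ?K"
    using S by (auto simp: subspace_def linear_0[OF lin] linear_add[OF lin] linear_scale[OF lin])
  have C: "subspace ?C"
    using S by (auto simp: subspace_def orthogonal_def inner_add_right)
  have sum: "dim ?C + dim ?K = dim S"
    by (rule dim_subspace_orthogonal_to_vectors[OF K S]) auto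
  have inj: "inj_on f ?C"
  proof (rule inj_onI)
    fix x y assume xy: "x \<in> ?C" "y \<in> ?C" "f x = f y"
    then have "x - y \<in> ?K"
      using subspace_diff[OF S] by (simp add: linear_diff[OF lin])
    moreover have "x - y \<in> ?C" using subspace_diff[OF C xy(1,2)] .
    ultimately have "orthogonal (x - y) (x - y)" by simp
    then show "x = y" by (simp add: orthogonal_def)
  qed
  have "f ` S \<subseteq> f ` ?C"
  proof
    fix z assume "z \<in> f ` S"
    then obtain x where x: "x \<in> S" "z = f x" by auto
    obtain y w where y: "y \<in> span ?K" "\<And>w'. w' \<in> span ?K \<Longrightarrow> orthogonal w w'" "x = y + w"
      using orthogonal_subspace_decomp_exists[of ?K x] by blast
    have "y \<in> ?K" using y(1) K by (metis span_eq_iff)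
    have "w = x - y" using y(3) by simp
    then have "w \<in> S" using subspace_diff[OF S x(1)] \<open>y \<in> ?K\<close> by simp
    moreover have "\<forall>x\<in>?K. orthogonal x w" using y(2)[OF span_base] by (simp add: orthogonal_commute)
    ultimately have wC: "w \<in> ?C" by simp
    have "f w = z" using x(2) y(3) \<open>y \<in> ?K\<close> by (simp add: linear_add[OF lin])
    then show "z \<in> f ` ?C" by (rule image_eqI[OF sym wC])
  qed
  then have "f ` S = f ` ?C" by auto
  moreover have "span ?C = ?C" using C by (simp only: span_eq_iff)
  with inj have "inj_on f (span ?C)" by (simp only:)
  then have "dim (f ` ?C) = dim ?C" by (rule dim_image_eq[OF lin])
  ultimately have "dim (f ` S) = dim ?C" by simp
  with sum show ?thesis by simp
qed

lemma dim_insert_not_in_subspace: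
  fixes S :: "'a::euclidean_space set"
  assumes "subspace S" "x \<notin> S"
  shows "dim (insert x S) = dim S + 1"
proof -
  have "x \<notin> span S" using assms by (metis span_eq_iff)
  with dim_insert[of x S] show ?thesis by simp
qed

lemma dim_add_direct:
  fixes S T :: "'a::euclidean_space set"
  assumes "subspace S" "subspace T" "S \<inter> T = {0}"
  shows "dim (span (S \<union> T)) = dim S + dim T"
proof -
  have "dim {x + y |x y. x \<in> S \<and> y \<in> T} + dim (S \<inter> T) = dim S + dim T"
    by (rule dim_sums_Int) fact+
  moreover have *: "span S = S" "span T = T" using assms by (simp_all only: span_eq_iff)
  ultimately show ?thesis using assms(3) unfolding span_Un * by simp
qed

text \<open>On an isotropic subspace the two negative coordinates determine the vector.\<close>

lemma isotropic_dim_le_2: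
  assumes L: "subspace L" and iso: "\<And>x. x \<in> L \<Longrightarrow> qform x = 0"
  shows "dim L \<le> 2"
proof -
  let ?f = "\<lambda>x :: real^5. (x $ 1, x $ 2)"
  have lin: "linear ?f" by (simp add: linear_iff)
  have "inj_on ?f L"
  proof (rule inj_onI)
    fix x y assume xy: "x \<in> L" "y \<in> L" "?f x = ?f y"
    have "qform (x - y) = 0" using iso subspace_diff[OF L xy(1,2)] .
    then have "((x - y) $ 3)\<^sup>2 + ((x - y) $ 4)\<^sup>2 + ((x - y) $ 5)\<^sup>2 = 0"
      using xy(3) by (simp add: qform_def)
    then have "(x - y) $ 3 = 0 \<and> (x - y) $ 4 = 0 \<and> (x - y) $ 5 = 0"
      by (simp add: add_nonneg_eq_0_iff)
    then show "x = y" using xy(3) by (simp add: vec_eq_iff forall_5)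
  qed
  then have "inj_on ?f (span L)" using L by (metis span_eq_iff)
  from dim_image_eq[OF lin this] have "dim L = dim (?f ` L)" by (rule sym)
  also have "\<dots> \<le> DIM(real \<times> real)" by (rule dim_subset_UNIV)
  finally show ?thesis by simp
qed

lemma dim_1_singleton:
  fixes L :: "'a::euclidean_space set"
  assumes "subspace L" "dim L = 1"
  obtains l where "l \<noteq> 0" "L = span {l}"
proof -
  obtain B where B: "B \<subseteq> L" "independent B" "L \<subseteq> span B" "card B = dim L"
    using basis_exists by blast
  then obtain l where "B = {l}" using assms card_1_singletonE by metis
  moreover have "span B \<subseteq> L" using B(1) assms(1) by (rule span_minimal)
  ultimately show thesis using B that[of l] by (auto simp: dependent_zero)
qed

lemma dim_2_pair:
  fixes L :: "'a::euclidean_space set"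
  assumes "subspace L" "dim L = 2"
  obtains a b where "a \<in> L" "b \<in> L" "L = span {a, b}" "independent {a, b}" "a \<noteq> b"
proof -
  obtain B where B: "B \<subseteq> L" "independent B" "L \<subseteq> span B" "card B = dim L"
    using basis_exists by blast
  then obtain a b where ab: "B = {a, b}" "a \<noteq> b" using assms by (metis card_2_iff)
  have "span B \<subseteq> L" using B(1) assms(1) by (rule span_minimal)
  with B(3) have "L = span B" by (intro equalityI)
  then have "L = span {a, b}" by (simp only: ab)
  moreover have "a \<in> L" "b \<in> L" "independent {a, b}" using B(1,2) by (simp_all add: ab)
  ultimately show thesis using ab(2) that by metis
qed

lemma bracket_apply: "(X ** Y - Y ** X) *v w = X *v (Y *v w) - Y *v (X *v (w :: real^'n))"
  by (simp add: mv.diff_left matrix_vector_mul_assoc)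

lemma independent_pair_zero_combination:
  fixes a b :: "'a::real_vector"
  assumes "independent {a, b}" "a \<noteq> b" "x *\<^sub>R a + y *\<^sub>R b = 0"
  shows "x = 0 \<and> y = 0"
proof -
  have ab: "a \<notin> span {b}" "b \<noteq> 0"
    using assms(1,2) by (simp_all add: independent_insert)
  have "x = 0"
  proof (rule ccontr)
    assume "x \<noteq> 0"
    have "x *\<^sub>R a = - (y *\<^sub>R b)" using assms(3) by (simp add: eq_neg_iff_add_eq_0)
    then have "(1 / x) *\<^sub>R (x *\<^sub>R a) = (1 / x) *\<^sub>R (- (y *\<^sub>R b))" by (simp only:)
    then have "a = (- (y / x)) *\<^sub>R b" using \<open>x \<noteq> 0\<close> by simp
    moreover have "(- (y / x)) *\<^sub>R b \<in> span {b}" by (intro span_scale span_base) simp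
    ultimately show False using ab(1) by metis
  qed
  with assms(3) ab(2) show ?thesis by simp
qed

lemma span_insert_subspace:
  assumes "subspace S"
  shows "span (insert x S) = {y. \<exists>c. y - c *\<^sub>R x \<in> S}"
proof -
  have "span S = S" using assms by (simp only: span_eq_iff)
  then show ?thesis unfolding span_insert by (simp only:)
qed

lemma one_dimensional_kernel:
  fixes X :: "real^'n^'n"
  assumes W: "subspace W" "dim W = 2" and k: "k \<in> W" "k \<noteq> 0" "X *v k = 0"
    and X0: "\<exists>w\<in>W. X *v w \<noteq> 0" and w: "w \<in> W" "X *v w = 0"
  shows "w \<in> span {k}"
proof (rule ccontr)
  assume "w \<notin> span {k}"
  have "dim (span (insert w (span {k}))) = 2"
    using dim_insert_not_in_subspace[OF subspace_span \<open>w \<notin> span {k}\<close>] k(2) by (simp add: dim_singleton)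
  moreover have "span (insert w (span {k})) \<subseteq> W"
    using w k by (intro span_minimal W) (auto simp: span_singleton intro: subspace_scale[OF W(1)])
  ultimately have "span (insert w (span {k})) = W" using W by (intro subspace_dim_equal) auto
  moreover have "span (insert w (span {k})) \<subseteq> {x. X *v x = 0}"
    using w k by (intro span_minimal) (auto simp: span_singleton subspace_def mv.zero_right mv.add_right mv.scaleR_right)
  ultimately show False using X0 by blast
qed

section \<open>Invariant subspaces of subalgebras of so(2,3)\<close>

definition invariant :: "(real^'n^'n) set \<Rightarrow> (real^'n) set \<Rightarrow> bool" where
  "invariant g L \<longleftrightarrow> (\<forall>X\<in>g. \<forall>w\<in>L. X *v w \<in> L)"

definition has_invariant_line :: "(real^'n^'n) set \<Rightarrow> bool" where
  "has_invariant_line g \<longleftrightarrow> (\<exists>l. l \<noteq> 0 \<and> invariant g (span {l}))"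

lemma invariantD: "invariant g L \<Longrightarrow> X \<in> g \<Longrightarrow> w \<in> L \<Longrightarrow> X *v w \<in> L"
  by (auto simp: invariant_def)

lemma invariant_span:
  assumes "\<And>X w. X \<in> g \<Longrightarrow> w \<in> S \<Longrightarrow> X *v w \<in> span S"
  shows "invariant g (span S)"
  unfolding invariant_def
proof (intro ballI)
  fix X w assume X: "X \<in> g" and "w \<in> span S"
  from this(2) show "X *v w \<in> span S"
    by (induction rule: span_induct_alt)
       (use assms X in \<open>auto simp: mv.zero_right mv.add_right mv.scaleR_right span_zero intro!: span_add span_scale\<close>)
qed

lemma invariant_line_of_eigenvector:
  assumes "l \<noteq> 0" "\<And>X. X \<in> g \<Longrightarrow> X *v l \<in> span {l}"
  shows "has_invariant_line g"
  unfolding has_invariant_line_def using assms invariant_span[of g "{l}"] by auto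

lemma invariant_line_of_dim_1:
  assumes "subspace L" "invariant g L" "dim L = 1"
  shows "has_invariant_line g"
  using dim_1_singleton[OF assms(1,3)] assms(2) by (metis has_invariant_line_def)

locale so23_subalgebra =
  fixes g :: "(real^5^5) set"
  assumes subspace_g: "subspace g"
    and bracket: "X \<in> g \<Longrightarrow> Y \<in> g \<Longrightarrow> X ** Y - Y ** X \<in> g"
    and skew: "X \<in> g \<Longrightarrow> bform (X *v x) y = - bform x (X *v y)"
begin

lemma skew_self: "X \<in> g \<Longrightarrow> bform (X *v x) x = 0"
  using skew[of X x x] bform_commute[of x "X *v x"] by simp

lemma invariant_perp: "invariant g L \<Longrightarrow> invariant g (perp L)"
  by (auto simp: invariant_def perp_def skew)

text \<open>The complement of an invariant hyperplane is an invariant line.\<close>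

lemma invariant_line_of_dim_4:
  assumes "subspace L" "invariant g L" "dim L = 4"
  shows "has_invariant_line g"
  using invariant_line_of_dim_1[OF subspace_perp invariant_perp[OF assms(2)]] dim_perp[OF assms(1)] assms(3)
  by simp

text \<open>The tangent space at \<open>v\<close> of the orbit of \<open>v\<close>, in the vector space; the tangent space of the projective
  orbit is its image modulo \<open>v\<close>.\<close>

definition orbit_tangent :: "real^5 \<Rightarrow> (real^5) set" where
  "orbit_tangent v = (\<lambda>X. X *v v) ` g"

lemma subspace_orbit_tangent: "subspace (orbit_tangent v)"
  unfolding orbit_tangent_def by (intro linear_subspace_image subspace_g) (rule bounded_linear.linear[OF mv.bounded_linear_left])

text \<open>Rank and nullity for \<open>X \<mapsto> X v\<close> modulo \<open>v\<close>, realized by the Euclidean projection \<open>f\<close> along \<open>v\<close>: this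
  expresses the dimension of the orbit of \<open>span {v}\<close> by a subspace of the vector space.\<close>

lemma orbit_tangent_dim:
  assumes v: "v \<noteq> 0"
  shows "dim g = dim {X \<in> g. X *v v \<in> span {v}} + (dim (span (insert v (orbit_tangent v))) - 1)"
proof -
  define f where "f X = X *v v - (((X *v v) \<bullet> v) / (v \<bullet> v)) *\<^sub>R v" for X :: "real^5^5"
  have lin: "linear f"
    by (simp add: f_def linear_iff mv.add_left mv.scaleR_left inner_add_left add_divide_distrib algebra_simps)
  have ker: "f X = 0 \<longleftrightarrow> X *v v \<in> span {v}" for X
  proof
    assume "X *v v \<in> span {v}"
    then show "f X = 0" using v by (auto simp: f_def span_singleton)
  qed (auto simp: f_def span_singleton)
  have orth: "f X \<bullet> v = 0" for X using v by (simp add: f_def inner_diff_left)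
  have sub: "subspace (f ` g)" using lin subspace_g by (rule linear_subspace_image)
  have "v \<notin> f ` g" using orth v by (metis imageE inner_eq_zero_iff)
  then have "dim (insert v (f ` g)) = dim (f ` g) + 1" by (rule dim_insert_not_in_subspace[OF sub])
  moreover have "span (insert v (f ` g)) = span (insert v (orbit_tangent v))"
  proof (rule span_eq[THEN iffD2], intro conjI subsetI)
    fix x assume "x \<in> insert v (f ` g)"
    then show "x \<in> span (insert v (orbit_tangent v))"
      by (auto simp: f_def orbit_tangent_def intro!: span_diff span_scale intro: span_base)
  next
    fix x assume "x \<in> insert v (orbit_tangent v)"
    then consider "x = v" | X where "X \<in> g" "x = X *v v" by (auto simp: orbit_tangent_def)
    then show "x \<in> span (insert v (f ` g))"
    proof cases
      case 2
      have "x = f X + (((X *v v) \<bullet> v) / (v \<bullet> v)) *\<^sub>R v" by (simp add: f_def 2)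
      moreover have "f X \<in> span (insert v (f ` g))" "v \<in> span (insert v (f ` g))"
        using 2 by (auto intro: span_base)
      ultimately show ?thesis by (metis span_add span_scale)
    qed (auto intro: span_base)
  qed
  ultimately have d: "dim (span (insert v (orbit_tangent v))) = dim (f ` g) + 1" by (metis dim_span)
  then show "dim g = dim {X \<in> g. X *v v \<in> span {v}} + (dim (span (insert v (orbit_tangent v))) - 1)"
    using dim_kernel_image[OF lin subspace_g] by (simp add: ker)
qed

text \<open>For null \<open>v\<close> in \<open>M\<close>, both \<open>v\<close> and \<open>g v\<close> lie in \<open>M \<inter> perp {v}\<close>, which is a proper subspace of \<open>M\<close> because
  \<open>M\<close> is nondegenerate.\<close>

lemma orbit_tangent_in_nondegenerate:
  assumes M: "subspace M" "invariant g M" "M \<inter> perp M = {0}" "dim M \<le> 3"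
    and v: "v \<in> M" "v \<noteq> 0" "qform v = 0"
  shows "dim (span (insert v (orbit_tangent v))) \<noteq> 3"
proof -
  let ?F = "perp (insert v (perp M))"
  have dP: "dim (perp M) + dim M = 5" by (rule dim_perp[OF M(1)])
  have "v \<notin> perp M" using M(3) v by blast
  then have "dim (span (insert v (perp M))) = 6 - dim M"
    using dim_insert_not_in_subspace[OF subspace_perp[of M]] dP by simp
  then have F: "dim ?F = dim M - 1"
    using dim_perp[OF subspace_span, of "insert v (perp M)"] dP by (simp add: perp_span)
  have "insert v (orbit_tangent v) \<subseteq> ?F"
  proof -
    have "v \<in> ?F" using v by (auto simp: perp_def bform_self bform_commute)
    moreover have "X *v v \<in> ?F" if "X \<in> g" for X
      using skew_self[OF that] invariantD[OF M(2) that v(1)] by (auto simp: perp_def bform_commute)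
    ultimately show ?thesis by (auto simp: orbit_tangent_def)
  qed
  then have "dim (span (insert v (orbit_tangent v))) \<le> dim ?F" by (simp add: dim_subset)
  with F M(4) show ?thesis by simp
qed

text \<open>The three-dimensional space \<open>span {v} + g v\<close> contains the direct sum of \<open>span {v}\<close> and \<open>S\<close>, so equals it
  and lies in \<open>N + span {v}\<close>. The latter is therefore an invariant hyperplane.\<close>

lemma invariant_line_of_transversal_orbit:
  assumes N: "subspace N" "invariant g N" "dim N = 3" and v: "v \<notin> N"
    and orbit: "dim (span (insert v (orbit_tangent v))) = 3"
    and S: "subspace S" "S \<subseteq> orbit_tangent v \<inter> N" "2 \<le> dim S"
  shows "has_invariant_line g"
proof -
  have "v \<notin> S" using S(2) v by blast
  then have "3 \<le> dim (span (insert v S))" using dim_insert_not_in_subspace[OF S(1)] S(3) by simp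
  moreover have "span (insert v S) \<subseteq> span (insert v (orbit_tangent v))" using S(2) by (intro span_mono) auto
  ultimately have "span (insert v S) = span (insert v (orbit_tangent v))"
    using orbit by (intro subspace_dim_equal) auto
  moreover have "span (insert v S) \<subseteq> span (insert v N)" using S(2) by (intro span_mono) auto
  ultimately have *: "orbit_tangent v \<subseteq> span (insert v N)"
    using span_superset[of "insert v (orbit_tangent v)"] by blast
  have "invariant g (span (insert v N))"
  proof (rule invariant_span)
    fix X w assume "X \<in> g" "w \<in> insert v N"
    then show "X *v w \<in> span (insert v N)"
      using * invariantD[OF N(2)] by (auto simp: orbit_tangent_def intro: span_base)
  qed
  moreover have "dim (span (insert v N)) = 4" using dim_insert_not_in_subspace[OF N(1) v] N(3) by simp
  ultimately show ?thesis by (intro invariant_line_of_dim_4[OF subspace_span])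
qed

end

section \<open>Invariant isotropic planes\<close>

context so23_subalgebra begin

text \<open>The element \<open>X\<close> is invertible on \<open>W\<close>, so it kills exactly one point \<open>n'\<close> of \<open>n + W\<close>. All of \<open>g\<close> kills
  \<open>n'\<close>: since \<open>X\<^sup>2 = - c\<close> on \<open>W\<close>, the operator \<open>ad X\<close> satisfies \<open>(ad X)\<^sup>3 + 4 c ad X = 0\<close> there, so for \<open>Y\<close> in
  \<open>g\<close> the element \<open>Z = (ad X)\<^sup>3 Y + 4 c ad X Y\<close> kills \<open>W\<close> and by \<open>faithful\<close> also \<open>n'\<close>. On the other
  hand \<open>Z n' = X\<^sup>3 Y n' + 4 c X Y n' = 3 c X Y n'\<close>.\<close>

lemma square_scalar_gives_invariant_line:
  assumes W: "subspace W" "invariant g W" and n: "n \<notin> W" "\<And>Y. Y \<in> g \<Longrightarrow> Y *v n \<in> W"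
    and faithful: "\<And>Y. Y \<in> g \<Longrightarrow> \<forall>w\<in>W. Y *v w = 0 \<Longrightarrow> Y *v n = 0"
    and X: "X \<in> g" "\<And>w. w \<in> W \<Longrightarrow> X *v (X *v w) = - c *\<^sub>R w" and c: "c \<noteq> 0"
  shows "has_invariant_line g"
proof (rule invariant_line_of_eigenvector)
  define n' where "n' = n + (1 / c) *\<^sub>R (X *v (X *v n))"
  have Xn: "X *v n \<in> W" by (rule n(2)[OF X(1)])
  have sW: "(1 / c) *\<^sub>R (X *v (X *v n)) \<in> W"
    by (intro subspace_scale[OF W(1)] invariantD[OF W(2) X(1)] Xn)
  show "n' \<noteq> 0"
  proof
    assume "n' = 0"
    then have "n = - ((1 / c) *\<^sub>R (X *v (X *v n)))" by (simp add: n'_def eq_neg_iff_add_eq_0)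
    then have "n \<in> W" using subspace_neg[OF W(1) sW] by metis
    then show False using n(1) by simp
  qed
  have Xn': "X *v n' = 0"
    using X(2)[OF Xn] c by (simp add: n'_def mv.add_right mv.scaleR_right)
  fix Y assume Y: "Y \<in> g"
  have Yn': "Y *v n' \<in> W"
    using subspace_add[OF W(1) n(2)[OF Y] invariantD[OF W(2) Y sW]] by (simp add: n'_def mv.add_right)
  let ?ad = "\<lambda>Z. X ** Z - Z ** X"
  have ad: "?ad Z \<in> g" if "Z \<in> g" for Z by (rule bracket[OF X(1) that])
  define Z where "Z = ?ad (?ad (?ad Y)) + (4 * c) *\<^sub>R ?ad Y"
  have Z: "Z \<in> g" unfolding Z_def by (intro subspace_add subspace_scale subspace_g ad Y)
  have ap: "Z *v x = X *v (X *v (X *v (Y *v x))) - 3 *\<^sub>R (X *v (X *v (Y *v (X *v x))))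
      + 3 *\<^sub>R (X *v (Y *v (X *v (X *v x)))) - Y *v (X *v (X *v (X *v x)))
      + (4 * c) *\<^sub>R (X *v (Y *v x)) - (4 * c) *\<^sub>R (Y *v (X *v x))" for x
    unfolding Z_def mv.add_left mv.scaleR_left bracket_apply mv.diff_right
    by (simp add: vec_eq_iff right_diff_distrib)
  have "Z *v w = 0" if w: "w \<in> W" for w
  proof -
    have "X *v w \<in> W" "Y *v w \<in> W" "Y *v (X *v w) \<in> W"
      using w invariantD[OF W(2)] X(1) Y by blast+
    then show ?thesis using w
      by (simp add: ap X(2) mv.minus_right mv.scaleR_right) (simp add: vec_eq_iff algebra_simps)
  qed
  then have "Z *v n = 0" using faithful[OF Z] by blast
  moreover have "Z *v ((1 / c) *\<^sub>R (X *v (X *v n))) = 0" using \<open>\<And>w. w \<in> W \<Longrightarrow> Z *v w = 0\<close> sW by blast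
  ultimately have "Z *v n' = 0" by (simp add: n'_def mv.add_right)
  then have "(3 * c) *\<^sub>R (X *v (Y *v n')) = 0"
    using X(2)[OF Yn'] by (simp add: ap Xn' mv.zero_right mv.minus_right mv.scaleR_right flip: scaleR_left_diff_distrib scaleR_add_left)
  then have "X *v (Y *v n') = 0" using c by simp
  then have "c *\<^sub>R (Y *v n') = 0" using X(2)[OF Yn'] by (simp add: mv.zero_right)
  then show "Y *v n' \<in> span {n'}" using c by (simp add: span_zero)
qed

text \<open>A commutator has trace zero on \<open>W\<close>, so this is the Cayley-Hamilton theorem; \<open>p\<close>, \<open>q\<close>, \<open>r\<close> and \<open>- p\<close> are the
  matrix entries of the commutator on the basis.\<close>

lemma commutator_square_is_scalar_on_plane:
  assumes ab: "W = span {a, b}" and W: "invariant g W" and XY: "X \<in> g" "Y \<in> g"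
  obtains c where "\<And>w. w \<in> W \<Longrightarrow> (X ** Y - Y ** X) *v ((X ** Y - Y ** X) *v w) = - c *\<^sub>R w"
proof -
  have mem: "a \<in> W" "b \<in> W" using ab by (auto intro: span_base)
  have coord: "\<exists>p q. w = p *\<^sub>R a + q *\<^sub>R b" if "w \<in> W" for w
    using that unfolding ab span_insert span_singleton by (auto simp: algebra_simps)
  obtain x1 x2 where Xa: "X *v a = x1 *\<^sub>R a + x2 *\<^sub>R b" using coord invariantD[OF W XY(1) mem(1)] by blast
  obtain x3 x4 where Xb: "X *v b = x3 *\<^sub>R a + x4 *\<^sub>R b" using coord invariantD[OF W XY(1) mem(2)] by blast
  obtain y1 y2 where Ya: "Y *v a = y1 *\<^sub>R a + y2 *\<^sub>R b" using coord invariantD[OF W XY(2) mem(1)] by blast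
  obtain y3 y4 where Yb: "Y *v b = y3 *\<^sub>R a + y4 *\<^sub>R b" using coord invariantD[OF W XY(2) mem(2)] by blast
  define p q r where "p = y2 * x3 - x2 * y3" and "q = y3 * x1 + y4 * x3 - x3 * y1 - x4 * y3"
    and "r = y1 * x2 + y2 * x4 - x1 * y2 - x2 * y4"
  let ?M = "X ** Y - Y ** X"
  have Ma: "?M *v a = p *\<^sub>R a + r *\<^sub>R b"
    unfolding bracket_apply p_def r_def by (simp add: Xa Xb Ya Yb mv.add_right mv.scaleR_right algebra_simps)
  have Mb: "?M *v b = q *\<^sub>R a - p *\<^sub>R b"
    unfolding bracket_apply p_def q_def by (simp add: Xa Xb Ya Yb mv.add_right mv.scaleR_right algebra_simps)
  have MMa: "?M *v (?M *v a) = (p * p + q * r) *\<^sub>R a"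
    by (simp only: Ma Mb mv.add_right mv.scaleR_right) (simp add: algebra_simps)
  have MMb: "?M *v (?M *v b) = (p * p + q * r) *\<^sub>R b"
    by (simp only: Ma Mb mv.diff_right mv.scaleR_right) (simp add: algebra_simps)
  show thesis
  proof
    fix w assume "w \<in> W"
    then obtain s t where "w = s *\<^sub>R a + t *\<^sub>R b" using coord by blast
    then show "?M *v (?M *v w) = - (- (p * p + q * r)) *\<^sub>R w"
      by (simp only: mv.add_right mv.scaleR_right MMa MMb) (simp add: algebra_simps)
  qed
qed

text \<open>Vanishing of the first cohomology for a plane without invariant line. Either some element squares to
  a nonzero scalar on \<open>W\<close>, which is settled above, or all commutators square to zero on \<open>W\<close>. If they vanish
  on \<open>W\<close>, a single \<open>X\<close> that is invertible on \<open>W\<close> has a zero in \<open>n + W\<close> and the others share it, while a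
  singular nonzero \<open>X\<close> has an invariant line as its kernel. Finally, the kernel of a nonzero nilpotent
  commutator \<open>N\<close> is invariant, because the commutators of \<open>N\<close> are nilpotent too.\<close>

lemma invariant_line_in_plane_extension:
  assumes W: "subspace W" "invariant g W" "dim W = 2" and n: "n \<notin> W" "\<And>Y. Y \<in> g \<Longrightarrow> Y *v n \<in> W"
    and faithful: "\<And>Y. Y \<in> g \<Longrightarrow> \<forall>w\<in>W. Y *v w = 0 \<Longrightarrow> Y *v n = 0"
  shows "has_invariant_line g"
proof -
  obtain a b where ab: "a \<in> W" "b \<in> W" "W = span {a, b}" "independent {a, b}" "a \<noteq> b"
    by (rule dim_2_pair[OF W(1,3)])
  have "a \<noteq> 0" using ab(4) dependent_zero by blast
  consider (square) X c where "X \<in> g" "c \<noteq> 0" "\<And>w. w \<in> W \<Longrightarrow> X *v (X *v w) = - c *\<^sub>R w"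
    | (abelian) "\<And>X Y w. X \<in> g \<Longrightarrow> Y \<in> g \<Longrightarrow> w \<in> W \<Longrightarrow> (X ** Y - Y ** X) *v w = 0"
    | (nilpotent) X Y where "X \<in> g" "Y \<in> g" "\<exists>w\<in>W. (X ** Y - Y ** X) *v w \<noteq> 0"
       "\<And>X Y w. X \<in> g \<Longrightarrow> Y \<in> g \<Longrightarrow> w \<in> W \<Longrightarrow> (X ** Y - Y ** X) *v ((X ** Y - Y ** X) *v w) = 0"
  proof -
    have "(\<exists>X\<in>g. \<exists>c. c \<noteq> 0 \<and> (\<forall>w\<in>W. X *v (X *v w) = - c *\<^sub>R w))
      \<or> (\<forall>X\<in>g. \<forall>Y\<in>g. \<forall>w\<in>W. (X ** Y - Y ** X) *v ((X ** Y - Y ** X) *v w) = 0)"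
    proof (rule disjCI, rule ccontr)
      assume "\<not> (\<forall>X\<in>g. \<forall>Y\<in>g. \<forall>w\<in>W. (X ** Y - Y ** X) *v ((X ** Y - Y ** X) *v w) = 0)"
      then obtain X Y w where XYw: "X \<in> g" "Y \<in> g" "w \<in> W" "(X ** Y - Y ** X) *v ((X ** Y - Y ** X) *v w) \<noteq> 0"
        by blast
      obtain c where c: "\<And>w. w \<in> W \<Longrightarrow> (X ** Y - Y ** X) *v ((X ** Y - Y ** X) *v w) = - c *\<^sub>R w"
        using commutator_square_is_scalar_on_plane[OF ab(3) W(2) XYw(1,2)] by blast
      have "c \<noteq> 0" using c[OF XYw(3)] XYw(4) by auto
      moreover assume "\<not> (\<exists>X\<in>g. \<exists>c. c \<noteq> 0 \<and> (\<forall>w\<in>W. X *v (X *v w) = - c *\<^sub>R w))"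
      ultimately show False using c bracket[OF XYw(1,2)] by blast
    qed
    then show thesis using square abelian nilpotent by metis
  qed
  then show ?thesis
  proof cases
    case square
    show ?thesis by (rule square_scalar_gives_invariant_line[OF W(1,2) n faithful square(1,3,2)])
  next
    case abelian
    have comm: "X *v (Y *v x) = Y *v (X *v x)" if "X \<in> g" "Y \<in> g" "x \<in> insert n W" for X Y x
      using abelian[OF that(1,2)] faithful[OF bracket[OF that(1,2)]] that(3) by (auto simp: bracket_apply)
    show ?thesis
    proof (cases "\<forall>X\<in>g. \<forall>w\<in>W. X *v w = 0")
      case True
      then show ?thesis
        using ab(1) by (intro invariant_line_of_eigenvector[OF \<open>a \<noteq> 0\<close>]) (simp add: span_zero)
    next
      case False
      then obtain X where X: "X \<in> g" "\<exists>w\<in>W. X *v w \<noteq> 0" by blast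
      show ?thesis
      proof (cases "\<exists>k\<in>W. k \<noteq> 0 \<and> X *v k = 0")
        case True
        then obtain k where k: "k \<in> W" "k \<noteq> 0" "X *v k = 0" by blast
        show ?thesis
        proof (rule invariant_line_of_eigenvector[OF k(2)])
          fix Y assume Y: "Y \<in> g"
          have "X *v (Y *v k) = 0" using comm[OF X(1) Y] k by (simp add: mv.zero_right)
          then show "Y *v k \<in> span {k}"
            using one_dimensional_kernel[OF W(1,3) k X(2)] invariantD[OF W(2) Y k(1)] by blast
        qed
      next
        case inj: False
        have "inj_on ((*v) X) W"
        proof (rule inj_onI)
          fix x y assume "x \<in> W" "y \<in> W" "X *v x = X *v y"
          then have "x - y \<in> W" "X *v (x - y) = 0" by (auto simp: mv.diff_right subspace_diff[OF W(1)])
          then show "x = y" using inj by auto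
        qed
        then have "inj_on ((*v) X) (span W)" using W(1) by (simp only: span_eq_iff[THEN iffD2])
        then have "dim ((*v) X ` W) = dim W" by (intro dim_image_eq) auto
        moreover have "subspace ((*v) X ` W)" by (rule linear_subspace_image) (auto simp: W)
        moreover have "(*v) X ` W \<subseteq> W" using invariantD[OF W(2) X(1)] by auto
        ultimately have "(*v) X ` W = W" using W(1) by (intro subspace_dim_equal) auto
        then have "X *v n \<in> (*v) X ` W" using n(2)[OF X(1)] by simp
        then obtain w0 where w0: "w0 \<in> W" "X *v n = X *v w0" by blast
        show ?thesis
        proof (rule invariant_line_of_eigenvector)
          show "n - w0 \<noteq> 0" using n(1) w0(1) by auto
          fix Y assume Y: "Y \<in> g"
          have "X *v (Y *v (n - w0)) = 0"
            using comm[OF X(1) Y, of n] comm[OF X(1) Y, of w0] w0 by (simp add: mv.diff_right)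
          moreover have "Y *v (n - w0) \<in> W"
            using n(2)[OF Y] invariantD[OF W(2) Y w0(1)] by (simp add: mv.diff_right subspace_diff[OF W(1)])
          ultimately have "Y *v (n - w0) = 0" using inj by blast
          then show "Y *v (n - w0) \<in> span {n - w0}" by (simp only: span_zero)
        qed
      qed
    qed
  next
    case nilpotent
    define N where "N = X ** Y - Y ** X"
    have N: "N \<in> g" "\<exists>w\<in>W. N *v w \<noteq> 0" unfolding N_def using nilpotent bracket by auto
    have NN: "N *v (N *v w) = 0" if "w \<in> W" for w unfolding N_def using nilpotent that by blast
    obtain j where j: "j \<in> W" "N *v j \<noteq> 0" using N(2) by blast
    define k where "k = N *v j"
    have k: "k \<in> W" "k \<noteq> 0" "N *v k = 0"
      using j NN invariantD[OF W(2) N(1)] by (auto simp: k_def)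
    note kernel = one_dimensional_kernel[OF W(1,3) k N(2)]
    show ?thesis
    proof (rule invariant_line_of_eigenvector[OF k(2)])
      fix Z assume Z: "Z \<in> g"
      have Zk: "Z *v k \<in> W" by (rule invariantD[OF W(2) Z k(1)])
      have NZk: "N *v (Z *v k) \<in> W" by (rule invariantD[OF W(2) N(1) Zk])
      have "(Z ** N - N ** Z) *v ((Z ** N - N ** Z) *v k) = 0"
        by (rule nilpotent(4)[OF Z N(1) k(1)])
      \<comment> \<open>Expand the square of \<open>[Z, N]\<close> on \<open>k\<close>, using \<open>N k = 0\<close> and \<open>N\<^sup>2 = 0\<close>.\<close>
      then have *: "N *v (Z *v (N *v (Z *v k))) = 0"
        using NN[OF Zk] by (simp add: bracket_apply k(3) mv.zero_right mv.minus_right)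
      have "N *v (Z *v k) \<in> span {k}" by (rule kernel[OF NZk NN[OF Zk]])
      then obtain c where c: "N *v (Z *v k) = c *\<^sub>R k" by (auto simp: span_singleton)
      then have "(c * c) *\<^sub>R k = 0" using * by (simp add: mv.scaleR_right)
      then have "N *v (Z *v k) = 0" using c k(2) by simp
      then show "Z *v k \<in> span {k}" by (rule kernel[OF Zk])
    qed
  qed
qed

text \<open>Null vectors of \<open>P = perp W\<close> lie in \<open>W\<close>, as isotropic subspaces have dimension at most two. Hence a null
  vector \<open>v\<close> in \<open>P\<close> would have \<open>g v\<close> in the plane \<open>W\<close>, which is too small. The cases are the possible
  dimensions of the space \<open>C\<close> of values at \<open>n\<close> of the ideal \<open>g0\<close> of elements that kill \<open>W\<close>.\<close>

lemma invariant_line_of_isotropic_plane: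
  assumes W: "subspace W" "invariant g W" "dim W = 2" "W \<subseteq> perp W"
    and v: "qform v = 0" and orbit: "dim (span (insert v (orbit_tangent v))) = 3"
  shows "has_invariant_line g"
proof -
  define P where "P = perp W"
  have P: "subspace P" "invariant g P" "W \<subseteq> P" "dim P = 3"
    using dim_perp[OF W(1)] W by (auto simp: P_def subspace_perp invariant_perp)
  have PW: "bform x w = 0" if "x \<in> P" "w \<in> W" for x w using that by (auto simp: P_def perp_def)
  have null: "x \<in> W" if x: "x \<in> P" "qform x = 0" for x
  proof (rule ccontr)
    assume "x \<notin> W"
    have "qform y = 0" if y: "y \<in> span (insert x W)" for y
    proof -
      obtain c where c: "y - c *\<^sub>R x \<in> W"
        using y unfolding span_insert_subspace[OF W(1)] by blast
      have "bform (y - c *\<^sub>R x) (y - c *\<^sub>R x) = 0" "bform (c *\<^sub>R x) (y - c *\<^sub>R x) = 0"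
        using c PW x P(3) by (auto simp: bf.scaleR_left)
      moreover have "qform (c *\<^sub>R x) = 0" using x(2) by (simp add: bf.scaleR_left bf.scaleR_right flip: bform_self) 
      ultimately show ?thesis using qform_add[of "c *\<^sub>R x" "y - c *\<^sub>R x"] by (simp add: bform_self)
    qed
    then have "dim (span (insert x W)) \<le> 2" by (intro isotropic_dim_le_2) auto
    then show False using dim_insert_not_in_subspace[OF W(1) \<open>x \<notin> W\<close>] W(3) by simp
  qed
  have "v \<notin> P"
  proof
    assume "v \<in> P"
    then have "v \<in> W" using null v by blast
    then have "insert v (orbit_tangent v) \<subseteq> W" using invariantD[OF W(2)] by (auto simp: orbit_tangent_def)
    then have "dim (span (insert v (orbit_tangent v))) \<le> dim W" by (simp add: dim_subset)
    then show False using orbit W(3) by simp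
  qed
  obtain n where n: "n \<in> P" "n \<notin> W" using P(3,4) W(3) by (metis subsetI subset_antisym numeral_eq_iff semiring_norm(87) semiring_norm(89))
  have qn: "qform n \<noteq> 0" using null n by blast
  have PnW: "\<exists>c. x - c *\<^sub>R n \<in> W" if "x \<in> P" for x
  proof -
    have "span (insert n W) = P"
    proof (rule subspace_dim_equal)
      show "span (insert n W) \<subseteq> P" using n P by (intro span_minimal) auto
    qed (use dim_insert_not_in_subspace[OF W(1) n(2)] W P in auto)
    then show ?thesis using that unfolding span_insert_subspace[OF W(1)] by blast
  qed
  have into_W: "x \<in> W" if "x \<in> P" "bform x n = 0" for x
  proof -
    obtain c where c: "x - c *\<^sub>R n \<in> W" using PnW[OF \<open>x \<in> P\<close>] by blast
    have "bform n (x - c *\<^sub>R n) = 0" using PW[OF n(1) c] .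
    then have "c = 0" using that(2) qn by (simp add: bf.diff_right bf.scaleR_right bform_self bform_commute[of n x])
    with c show ?thesis by simp
  qed
  have gn: "Y *v n \<in> W" if "Y \<in> g" for Y
    using into_W invariantD[OF P(2) that n(1)] skew_self[OF that] by blast
  define g0 where "g0 = {X \<in> g. \<forall>w\<in>W. X *v w = 0}"
  have g0: "subspace g0" "\<And>X. X \<in> g0 \<Longrightarrow> X \<in> g" "\<And>X w. X \<in> g0 \<Longrightarrow> w \<in> W \<Longrightarrow> X *v w = 0"
    using subspace_g by (auto simp: g0_def subspace_def mv.zero_left mv.add_left mv.scaleR_left)
  have ideal: "Y ** X - X ** Y \<in> g0" if "Y \<in> g" "X \<in> g0" for X Y
    using that bracket[of Y X] invariantD[OF W(2) that(1)] by (auto simp: g0_def bracket_apply mv.zero_right)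
  define C where "C = (\<lambda>X. X *v n) ` g0"
  have C: "subspace C" "C \<subseteq> W"
    unfolding C_def using gn g0
    by (auto intro!: linear_subspace_image bounded_linear.linear[OF mv.bounded_linear_left])
  have "invariant g C"
    unfolding invariant_def
  proof (intro ballI)
    fix Y w assume Y: "Y \<in> g" and "w \<in> C"
    then obtain X where X: "X \<in> g0" "w = X *v n" by (auto simp: C_def)
    have "Y *v w = (Y ** X - X ** Y) *v n" using g0(3)[OF X(1) gn[OF Y]] by (simp add: bracket_apply X(2))
    then show "Y *v w \<in> C" using ideal[OF Y X(1)] by (auto simp: C_def)
  qed
  have "dim C \<le> 2" using dim_subset[OF C(2)] W(3) by simp
  then consider "dim C = 1" | "dim C = 0" | "dim C = 2" by linarith
  then show ?thesis
  proof cases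
    case 1
    then show ?thesis by (rule invariant_line_of_dim_1[OF C(1) \<open>invariant g C\<close>])
  next
    case 2
    then have "C \<subseteq> {0}" by simp
    show ?thesis
    proof (rule invariant_line_in_plane_extension[OF W(1,2,3) n(2) gn])
      fix Y assume "Y \<in> g" "\<forall>w\<in>W. Y *v w = 0"
      then have "Y *v n \<in> C" by (auto simp: C_def g0_def)
      with \<open>C \<subseteq> {0}\<close> show "Y *v n = 0" by blast
    qed
  next
    case 3
    then have CW: "C = W" using C W by (intro subspace_dim_equal) auto
    obtain a b where ab: "a \<in> W" "b \<in> W" "W = span {a, b}" "independent {a, b}" "a \<noteq> b"
      by (rule dim_2_pair[OF W(1,3)])
    \<comment> \<open>\<open>X v\<close> lies in \<open>P\<close> but not in \<open>W\<close>, whereas \<open>[Y, X] v\<close> is a nonzero multiple of \<open>w'\<close> in \<open>W\<close>.\<close>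
    obtain w where w: "w \<in> W" "bform v w \<noteq> 0" using \<open>v \<notin> P\<close> by (auto simp: P_def perp_def)
    define w' where "w' = bform v b *\<^sub>R a - bform v a *\<^sub>R b"
    have "\<not> (bform v a = 0 \<and> bform v b = 0)"
    proof
      assume "bform v a = 0 \<and> bform v b = 0"
      then have "v \<in> perp {a, b}" by (simp add: perp_def)
      then have "v \<in> P" by (simp add: P_def ab(3) perp_span)
      then show False using \<open>v \<notin> P\<close> by simp
    qed
    then have "w' \<noteq> 0"
      using independent_pair_zero_combination[OF ab(4,5), of "bform v b" "- bform v a"] by (auto simp: w'_def)
    have w': "w' \<in> W" "bform v w' = 0"
      by (auto simp: w'_def bf.diff_right bf.scaleR_right intro!: subspace_diff subspace_scale W ab)
    obtain X where X: "X \<in> g0" "X *v n = w" using w CW by (auto simp: C_def)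
    obtain Y where Y: "Y \<in> g0" "Y *v n = w'" using w' CW by (auto simp: C_def)
    have gP: "Z *v v \<in> P" if "Z \<in> g0" for Z
      using skew[OF g0(2)[OF that], of v] g0(3)[OF that] by (simp add: P_def perp_def bf.zero_right)
    have Xvn: "bform (X *v v) n \<noteq> 0" using skew[OF g0(2)[OF X(1)], of v n] w(2) X(2) by simp
    have "X *v v \<notin> W" using Xvn PW[OF n(1)] bform_commute[of n "X *v v"] by auto
    have YvW: "Y *v v \<in> W"
      using into_W[OF gP[OF Y(1)]] skew[OF g0(2)[OF Y(1)], of v n] w'(2) Y(2) by simp
    obtain c where c: "X *v v - c *\<^sub>R n \<in> W" using PnW[OF gP[OF X(1)]] by blast
    have "c \<noteq> 0" using c \<open>X *v v \<notin> W\<close> by auto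
    have "Y *v (X *v v) = c *\<^sub>R w'"
      using g0(3)[OF Y(1) c] Y(2) by (simp add: mv.diff_right mv.scaleR_right)
    moreover have "X *v (Y *v v) = 0" by (rule g0(3)[OF X(1) YvW])
    ultimately have "(Y ** X - X ** Y) *v v = c *\<^sub>R w'" by (simp add: bracket_apply)
    moreover have "(Y ** X - X ** Y) *v v \<in> orbit_tangent v"
      using bracket[OF g0(2)[OF Y(1)] g0(2)[OF X(1)]] by (auto simp: orbit_tangent_def)
    ultimately have "c *\<^sub>R w' \<in> orbit_tangent v" by simp
    then have "(1 / c) *\<^sub>R (c *\<^sub>R w') \<in> orbit_tangent v"
      by (rule subspace_scale[OF subspace_orbit_tangent])
    then have w'o: "w' \<in> orbit_tangent v" using \<open>c \<noteq> 0\<close> by simp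
    have Xvo: "X *v v \<in> orbit_tangent v" using g0(2)[OF X(1)] by (auto simp: orbit_tangent_def)
    define S where "S = span (insert (X *v v) (span {w'}))"
    show ?thesis
    proof (rule invariant_line_of_transversal_orbit[OF P(1,2,4) \<open>v \<notin> P\<close> orbit])
      show "subspace S" by (simp add: S_def)
      have "span {w'} \<subseteq> W" using w' W by (intro span_minimal) auto
      then have "X *v v \<notin> span {w'}" using \<open>X *v v \<notin> W\<close> by blast
      then have "dim (insert (X *v v) (span {w'})) = dim (span {w'}) + 1"
        by (rule dim_insert_not_in_subspace[OF subspace_span])
      then show "2 \<le> dim S" using \<open>w' \<noteq> 0\<close> by (simp add: S_def dim_singleton)
      have "span {w'} \<subseteq> orbit_tangent v \<inter> P"
        using w'o w' P by (intro span_minimal subspace_inter subspace_orbit_tangent) auto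
      then show "S \<subseteq> orbit_tangent v \<inter> P"
        unfolding S_def using Xvo gP[OF X(1)] P(1)
        by (intro span_minimal subspace_inter subspace_orbit_tangent) auto
    qed
  qed
qed

end

section \<open>Invariant nondegenerate planes\<close>

text \<open>A nondegenerate space contains a vector that is not null, by polarization, and splits off its span.\<close>

lemma nondegenerate_split:
  assumes M: "subspace M" "M \<inter> perp M = {0}" "M \<noteq> {0}"
  obtains a where "a \<in> M" "qform a \<noteq> 0" "subspace (M \<inter> perp {a})"
    "(M \<inter> perp {a}) \<inter> perp (M \<inter> perp {a}) = {0}" "dim (M \<inter> perp {a}) = dim M - 1"
    "span (insert a (M \<inter> perp {a})) = M"
proof -
  have "\<exists>a\<in>M. qform a \<noteq> 0"
  proof (rule ccontr)
    assume "\<not> ?thesis"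
    then have "qform x = 0" if "x \<in> M" for x using that by blast
    then have "bform x y = 0" if "x \<in> M" "y \<in> M" for x y
      using qform_add[of x y] that subspace_add[OF M(1) that] by simp
    then have "M \<subseteq> M \<inter> perp M" by (auto simp: perp_def)
    with M show False by (metis Int_lower1 subset_antisym)
  qed
  then obtain a where a: "a \<in> M" "qform a \<noteq> 0" by blast
  define M' where "M' = M \<inter> perp {a}"
  have M': "subspace M'" unfolding M'_def by (intro subspace_inter M subspace_perp)
  have "a \<notin> M'" using a(2) by (auto simp: M'_def perp_def bform_self)
  have dec: "x - (bform x a / qform a) *\<^sub>R a \<in> M'" if "x \<in> M" for x
    using that a by (auto simp: M'_def perp_def bf.diff_left bf.scaleR_left bform_self
        intro!: subspace_diff[OF M(1)] subspace_scale[OF M(1)])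
  have span: "span (insert a M') = M"
  proof
    show "span (insert a M') \<subseteq> M" using a(1) by (intro span_minimal M(1)) (auto simp: M'_def)
    show "M \<subseteq> span (insert a M')" using dec by (auto simp: span_insert_subspace[OF M'])
  qed
  then have "dim M = dim M' + 1" using dim_insert_not_in_subspace[OF M' \<open>a \<notin> M'\<close>] by (metis dim_span)
  moreover have "M' \<inter> perp M' = {0}"
  proof (intro equalityI subsetI)
    fix x assume x: "x \<in> M' \<inter> perp M'"
    have "x \<in> perp (insert a M')" using x by (auto simp: M'_def perp_def)
    then have "x \<in> perp M" using perp_span[of "insert a M'"] span by simp
    with x M(2) show "x \<in> {0}" by (auto simp: M'_def)
  qed (use M' subspace_0[OF subspace_perp] in \<open>auto simp: subspace_0\<close>)
  ultimately show thesis using that[of a] a M' span by (simp add: M'_def)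
qed

lemma orthogonal_basis_3:
  assumes E: "subspace E" "E \<inter> perp E = {0}" "dim E = 3"
  obtains e1 e2 e3 where "E = span {e1, e2, e3}" "qform e1 \<noteq> 0" "qform e2 \<noteq> 0" "qform e3 \<noteq> 0"
    "bform e1 e2 = 0" "bform e1 e3 = 0" "bform e2 e3 = 0"
proof -
  have E0: "E \<noteq> {0}" using E(3) by auto
  obtain e1 where e1: "e1 \<in> E" "qform e1 \<noteq> 0" "subspace (E \<inter> perp {e1})"
    "(E \<inter> perp {e1}) \<inter> perp (E \<inter> perp {e1}) = {0}" "dim (E \<inter> perp {e1}) = dim E - 1"
    "span (insert e1 (E \<inter> perp {e1})) = E"
    by (rule nondegenerate_split[OF E(1,2) E0])
  define E1 where "E1 = E \<inter> perp {e1}"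
  note e1 = e1[folded E1_def]
  have "E1 \<noteq> {0}" using e1(5) E(3) by auto
  obtain e2 where e2: "e2 \<in> E1" "qform e2 \<noteq> 0" "subspace (E1 \<inter> perp {e2})"
    "(E1 \<inter> perp {e2}) \<inter> perp (E1 \<inter> perp {e2}) = {0}" "dim (E1 \<inter> perp {e2}) = dim E1 - 1"
    "span (insert e2 (E1 \<inter> perp {e2})) = E1"
    by (rule nondegenerate_split[OF e1(3,4) \<open>E1 \<noteq> {0}\<close>])
  define E2 where "E2 = E1 \<inter> perp {e2}"
  note e2 = e2[folded E2_def]
  have "dim E2 = 1" using E e1 e2 by simp
  then obtain e3 where e3: "e3 \<noteq> 0" "E2 = span {e3}" using dim_1_singleton[OF e2(3)] by metis
  have "e3 \<in> E2" unfolding e3(2) by (rule span_base) simp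
  have "qform e3 \<noteq> 0"
  proof
    assume "qform e3 = 0"
    then have "e3 \<in> perp {e3}" by (simp add: perp_def bform_self)
    then have "e3 \<in> perp E2" by (simp add: e3(2) perp_span)
    with \<open>e3 \<in> E2\<close> e2(4) e3(1) show False by blast
  qed
  moreover have "bform e1 e2 = 0" "bform e1 e3 = 0" "bform e2 e3 = 0"
    using \<open>e3 \<in> E2\<close> e2(1) by (auto simp: E1_def E2_def perp_def bform_commute)
  moreover have "E = span {e1, e2, e3}"
  proof
    have "E2 \<subseteq> span {e1, e2, e3}" unfolding e3(2) by (rule span_mono) auto
    then have "span (insert e2 E2) \<subseteq> span {e1, e2, e3}" by (intro span_minimal) (auto intro: span_base)
    then have "E1 \<subseteq> span {e1, e2, e3}" using e2(6) by simp
    then have "span (insert e1 E1) \<subseteq> span {e1, e2, e3}" by (intro span_minimal) (auto intro: span_base)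
    then show "E \<subseteq> span {e1, e2, e3}" using e1(6) by simp
    have "e1 \<in> E" "e2 \<in> E" "e3 \<in> E" using e1 e2 \<open>e3 \<in> E2\<close> by (auto simp: E1_def E2_def)
    then show "span {e1, e2, e3} \<subseteq> E" by (intro span_minimal E) auto
  qed
  ultimately show thesis using that e1 e2 by blast
qed

locale orthogonal_frame =
  fixes E :: "(real^5) set" and e1 e2 e3 :: "real^5"
  assumes E: "E = span {e1, e2, e3}"
    and norms: "qform e1 \<noteq> 0" "qform e2 \<noteq> 0" "qform e3 \<noteq> 0"
    and orth: "bform e1 e2 = 0" "bform e1 e3 = 0" "bform e2 e3 = 0"
begin

lemma orth': "bform e2 e1 = 0" "bform e3 e1 = 0" "bform e3 e2 = 0"
  using orth by (simp_all add: bform_commute)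

lemma frame_in: "e1 \<in> E" "e2 \<in> E" "e3 \<in> E"
  by (auto simp: E intro: span_base)

lemma subspace_E: "subspace E" by (simp add: E)

lemma coordinates:
  assumes "x \<in> E"
  shows "x = (bform x e1 / qform e1) *\<^sub>R e1 + (bform x e2 / qform e2) *\<^sub>R e2 + (bform x e3 / qform e3) *\<^sub>R e3"
proof -
  obtain p q r where "x = p *\<^sub>R e1 + q *\<^sub>R e2 + r *\<^sub>R e3"
    using assms unfolding E span_insert span_empty by (auto simp: algebra_simps)
  then show ?thesis
    using norms by (simp add: bf.add_left bf.scaleR_left orth orth' bform_self)
qed

lemma bform_coordinates:
  assumes "x \<in> E"
  shows "bform x y = bform x e1 * bform e1 y / qform e1 + bform x e2 * bform e2 y / qform e2 + bform x e3 * bform e3 y / qform e3"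
  by (subst coordinates[OF assms]) (simp add: bf.add_left bf.scaleR_left)

lemma eq_by_coordinates:
  assumes "x \<in> E" "y \<in> E" "bform x e1 = bform y e1" "bform x e2 = bform y e2" "bform x e3 = bform y e3"
  shows "x = y"
  using coordinates[OF assms(1)] coordinates[OF assms(2)] assms(3-5) by simp

text \<open>The vector representing the alternating form \<open>(x, y) \<mapsto> bform (X x) y\<close> on \<open>E\<close>: its coordinates are the
  independent entries of that form in cyclic order, and the sign pattern of the frame does not enter. It spans
  the kernel of a nonzero \<open>X\<close> on \<open>E\<close>.\<close>

definition axis :: "real^5^5 \<Rightarrow> real^5" where
  "axis X = bform (X *v e2) e3 *\<^sub>R e1 + bform (X *v e3) e1 *\<^sub>R e2 + bform (X *v e1) e2 *\<^sub>R e3"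

lemma linear_axis: "linear axis"
  by (simp add: linear_iff axis_def mv.add_left mv.scaleR_left bf.add_left bf.scaleR_left algebra_simps)

lemma axis_in: "axis X \<in> E"
  unfolding axis_def by (intro subspace_add subspace_scale subspace_E frame_in)

end

context so23_subalgebra begin

lemma skew_swap: "X \<in> g \<Longrightarrow> bform (X *v x) y = - bform (X *v y) x"
  using skew[of X x y] bform_commute[of x "X *v y"] by simp

text \<open>An element that is skew for the form has trace zero on \<open>E\<close> and preserves the volume form, through which the axis is
  defined; in the frame this is a comparison of coordinates.\<close>

lemma axis_equivariant:
  assumes frame: "orthogonal_frame E e1 e2 e3" and inv: "invariant g E" and Y: "Y \<in> g" and X: "X \<in> g"
  shows "orthogonal_frame.axis e1 e2 e3 (Y ** X - X ** Y) = Y *v orthogonal_frame.axis e1 e2 e3 X"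
proof -
  interpret orthogonal_frame E e1 e2 e3 by (rule frame)
  have ent: "bform (Z *v e1) e1 = 0" "bform (Z *v e2) e2 = 0" "bform (Z *v e3) e3 = 0"
    "bform (Z *v e2) e1 = - bform (Z *v e1) e2" "bform (Z *v e1) e3 = - bform (Z *v e3) e1"
    "bform (Z *v e3) e2 = - bform (Z *v e2) e3" if "Z \<in> g" for Z
    using skew_swap[OF that] skew_self[OF that] by blast+
  have in_E: "Z *v x \<in> E" if "Z \<in> g" "x \<in> E" for Z x using invariantD[OF inv that] .
  have YX: "Y ** X - X ** Y \<in> g" by (rule bracket[OF Y X])
  have entry: "bform ((Y ** X - X ** Y) *v x) y = bform (Y *v x) (X *v y) - bform (X *v x) (Y *v y)" for x y
    by (simp add: bracket_apply bf.diff_left skew[OF X] skew[OF Y])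
  show ?thesis
  proof (rule eq_by_coordinates[OF axis_in in_E[OF Y axis_in]])
    show "bform (axis (Y ** X - X ** Y)) e1 = bform (Y *v axis X) e1"
      using norms
      by (simp add: axis_def bf.add_left bf.scaleR_left mv.add_right mv.scaleR_right orth orth' bform_self entry
          bform_coordinates[OF in_E[OF X frame_in(2)], of "Y *v e3"] bform_coordinates[OF in_E[OF Y frame_in(2)], of "X *v e3"]
          ent[OF X] ent[OF Y] bform_commute[of e1 "_ *v _"] bform_commute[of e2 "_ *v _"] bform_commute[of e3 "_ *v _"])
        (simp add: field_simps)
    show "bform (axis (Y ** X - X ** Y)) e2 = bform (Y *v axis X) e2"
      using norms
      by (simp add: axis_def bf.add_left bf.scaleR_left mv.add_right mv.scaleR_right orth orth' bform_self entry
          bform_coordinates[OF in_E[OF X frame_in(3)], of "Y *v e1"] bform_coordinates[OF in_E[OF Y frame_in(3)], of "X *v e1"]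
          ent[OF X] ent[OF Y] bform_commute[of e1 "_ *v _"] bform_commute[of e2 "_ *v _"] bform_commute[of e3 "_ *v _"])
        (simp add: field_simps)
    show "bform (axis (Y ** X - X ** Y)) e3 = bform (Y *v axis X) e3"
      using norms
      by (simp add: axis_def bf.add_left bf.scaleR_left mv.add_right mv.scaleR_right orth orth' bform_self entry
          bform_coordinates[OF in_E[OF X frame_in(1)], of "Y *v e2"] bform_coordinates[OF in_E[OF Y frame_in(1)], of "X *v e2"]
          ent[OF X] ent[OF Y] bform_commute[of e1 "_ *v _"] bform_commute[of e2 "_ *v _"] bform_commute[of e3 "_ *v _"])
        (simp add: field_simps)
  qed
qed

lemma axis_eq_0:
  assumes frame: "orthogonal_frame E e1 e2 e3" and inv: "invariant g E" and X: "X \<in> g"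
    and 0: "orthogonal_frame.axis e1 e2 e3 X = 0" and x: "x \<in> E"
  shows "X *v x = 0"
proof -
  interpret orthogonal_frame E e1 e2 e3 by (rule frame)
  have "bform (axis X) e1 = 0" "bform (axis X) e2 = 0" "bform (axis X) e3 = 0"
    by (simp_all add: 0 bf.zero_left)
  then have x123: "bform (X *v e2) e3 = 0" "bform (X *v e3) e1 = 0" "bform (X *v e1) e2 = 0"
    using norms by (simp_all add: axis_def bf.add_left bf.scaleR_left orth orth' bform_self)
  have "X *v e = 0" if e: "e \<in> {e1, e2, e3}" for e
  proof (rule eq_by_coordinates)
    show "X *v e \<in> E" using e frame_in invariantD[OF inv X] by blast
    show "0 \<in> E" by (rule subspace_0[OF subspace_E])
    show "bform (X *v e) e1 = bform 0 e1" "bform (X *v e) e2 = bform 0 e2" "bform (X *v e) e3 = bform 0 e3"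
      using e x123 skew_self[OF X] skew_swap[of X e1 e3, OF X] skew_swap[of X e2 e1, OF X] skew_swap[of X e3 e2, OF X]
      by (auto simp: bf.zero_left)
  qed
  then show ?thesis
    by (subst coordinates[OF x]) (simp add: mv.add_right mv.scaleR_right)
qed

text \<open>In coordinates, \<open>X e = 0\<close> says that the cross product of the axis with \<open>e\<close> vanishes.\<close>

lemma axis_of_stabilizer:
  assumes frame: "orthogonal_frame E e1 e2 e3" and X: "X \<in> g"
    and e: "e \<in> E" "e \<noteq> 0" "X *v e = 0"
  shows "orthogonal_frame.axis e1 e2 e3 X \<in> span {e}"
proof -
  interpret orthogonal_frame E e1 e2 e3 by (rule frame)
  define a1 a2 a3 where "a1 = bform e e1 / qform e1" and "a2 = bform e e2 / qform e2" and "a3 = bform e e3 / qform e3"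
  have e_eq: "e = a1 *\<^sub>R e1 + a2 *\<^sub>R e2 + a3 *\<^sub>R e3"
    using coordinates[OF e(1)] by (simp add: a1_def a2_def a3_def)
  define x1 x2 x3 where "x1 = bform (X *v e2) e3" and "x2 = bform (X *v e3) e1" and "x3 = bform (X *v e1) e2"
  have ent: "bform (X *v e1) e1 = 0" "bform (X *v e2) e2 = 0" "bform (X *v e3) e3 = 0"
    "bform (X *v e2) e1 = - x3" "bform (X *v e1) e3 = - x2" "bform (X *v e3) e2 = - x1"
    unfolding x1_def x2_def x3_def using skew_swap[OF X] skew_self[OF X] by blast+
  have "bform (X *v e) e1 = 0" "bform (X *v e) e2 = 0" "bform (X *v e) e3 = 0"
    by (simp_all add: e(3) bf.zero_left)
  then have cross: "a3 * x2 = a2 * x3" "a1 * x3 = a3 * x1" "a2 * x1 = a1 * x2"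
    unfolding e_eq mv.add_right mv.scaleR_right bf.add_left bf.scaleR_left
    by (simp_all add: ent flip: x1_def x2_def x3_def)
  have ax: "axis X = x1 *\<^sub>R e1 + x2 *\<^sub>R e2 + x3 *\<^sub>R e3" by (simp add: axis_def x1_def x2_def x3_def)
  have parallel: "axis X = c *\<^sub>R e" if "x1 = c * a1" "x2 = c * a2" "x3 = c * a3" for c
    unfolding ax that by (simp add: e_eq algebra_simps)
  have "a1 \<noteq> 0 \<or> a2 \<noteq> 0 \<or> a3 \<noteq> 0" using e(2) e_eq by auto
  then have "\<exists>c. axis X = c *\<^sub>R e"
  proof (elim disjE)
    assume "a1 \<noteq> 0"
    then have "x1 = x1 / a1 * a1" "x2 = x1 / a1 * a2" "x3 = x1 / a1 * a3"
      using cross by (simp_all add: field_simps)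
    then show ?thesis using parallel by blast
  next
    assume "a2 \<noteq> 0"
    then have "x1 = x2 / a2 * a1" "x2 = x2 / a2 * a2" "x3 = x2 / a2 * a3"
      using cross by (simp_all add: field_simps)
    then show ?thesis using parallel by blast
  next
    assume "a3 \<noteq> 0"
    then have "x1 = x3 / a3 * a1" "x2 = x3 / a3 * a2" "x3 = x3 / a3 * a3"
      using cross by (simp_all add: field_simps)
    then show ?thesis using parallel by blast
  qed
  then show ?thesis by (auto simp: span_singleton)
qed

text \<open>Both components of \<open>v = u + e\<close> in \<open>W \<oplus> E\<close> are nonzero, as orbits inside nondegenerate subspaces are too
  small. The ideal \<open>g1\<close> of elements killing \<open>W\<close> is identified with the invariant subspace \<open>S\<close> of \<open>E\<close> formed by
  the axes of its elements, and the cases are the dimensions of \<open>S\<close>. If \<open>S = E\<close>, then \<open>g1\<close> has dimension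
  three and the stabilizer of \<open>e\<close> in it has dimension at most one, so \<open>g1 v = g1 e\<close> is large enough.\<close>

lemma invariant_line_of_nondegenerate_plane:
  assumes W: "subspace W" "invariant g W" "dim W = 2" "W \<inter> perp W = {0}"
    and v: "v \<noteq> 0" "qform v = 0" and orbit: "dim (span (insert v (orbit_tangent v))) = 3"
  shows "has_invariant_line g"
proof -
  define E where "E = perp W"
  have Ep: "subspace E" "invariant g E" "dim E = 3"
    using dim_perp[OF W(1)] W by (auto simp: E_def subspace_perp invariant_perp)
  have EW: "bform x w = 0" if "x \<in> E" "w \<in> W" for x w using that by (auto simp: E_def perp_def)
  then have WE: "bform w x = 0" if "x \<in> E" "w \<in> W" for x w using that bform_commute[of w x] by simp
  have "W \<subseteq> perp E" using WE by (auto simp: perp_def)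
  moreover have "dim (perp E) = 2" using dim_perp[OF Ep(1)] Ep(3) by simp
  ultimately have "W = perp E" using W by (intro subspace_dim_equal subspace_perp) auto
  then have Ed: "E \<inter> perp E = {0}" using W(4) by (simp add: E_def Int_commute)
  have sum: "span (W \<union> E) = UNIV"
  proof (rule subspace_dim_equal)
    show "dim (UNIV :: (real^5) set) \<le> dim (span (W \<union> E))"
      using dim_add_direct[OF W(1) Ep(1)] W(3,4) Ep(3) by (simp add: E_def)
  qed auto
  then have "v \<in> span (W \<union> E)" by simp
  moreover have "span W = W" "span E = E" using W(1) Ep(1) by (simp_all only: span_eq_iff)
  ultimately obtain u e where ue: "u \<in> W" "e \<in> E" "v = u + e" unfolding span_Un by auto
  have "u \<noteq> 0"
  proof
    assume "u = 0"
    then show False using orbit_tangent_in_nondegenerate[OF Ep(1,2) Ed _ _ v] Ep(3) ue orbit by simp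
  qed
  have "e \<noteq> 0"
  proof
    assume "e = 0"
    then show False using orbit_tangent_in_nondegenerate[OF W(1,2,4) _ _ v] W(3) ue orbit by simp
  qed
  have "v \<notin> E"
  proof
    assume "v \<in> E"
    then have "v - e \<in> E" by (rule subspace_diff[OF Ep(1) _ ue(2)])
    then have "u \<in> E" by (simp add: ue(3))
    then show False using ue(1) W(4) \<open>u \<noteq> 0\<close> by (auto simp: E_def)
  qed
  define g1 where "g1 = {X \<in> g. \<forall>w\<in>W. X *v w = 0}"
  have g1: "subspace g1" "\<And>X. X \<in> g1 \<Longrightarrow> X \<in> g" "\<And>X w. X \<in> g1 \<Longrightarrow> w \<in> W \<Longrightarrow> X *v w = 0"
    using subspace_g by (auto simp: g1_def subspace_def mv.zero_left mv.add_left mv.scaleR_left)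
  have ideal: "Y ** X - X ** Y \<in> g1" if "Y \<in> g" "X \<in> g1" for X Y
    using that bracket[of Y X] invariantD[OF W(2) that(1)] by (auto simp: g1_def bracket_apply mv.zero_right)
  have "g1 \<noteq> {0}"
  proof
    assume g1_0: "g1 = {0}"
    obtain a b where ab: "a \<in> W" "b \<in> W" "W = span {a, b}" "independent {a, b}" "a \<noteq> b"
      by (rule dim_2_pair[OF W(1,3)])
    \<comment> \<open>The action on the plane \<open>W\<close> is determined by the single number \<open>d X\<close>.\<close>
    define d where "d X = bform (X *v a) b" for X
    have kill: "X = 0" if X: "X \<in> g" "d X = 0" for X
    proof -
      have "X *v w = 0" if "w \<in> {a, b}" for w
      proof -
        have "bform (X *v w) a = 0 \<and> bform (X *v w) b = 0"
          using that X(2) skew_self[OF X(1)] skew_swap[OF X(1), of b a] by (auto simp: d_def)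
        then have "X *v w \<in> perp {a, b}" by (simp add: perp_def)
        then have "X *v w \<in> perp W" by (simp add: ab(3) perp_span)
        moreover have "X *v w \<in> W" using that ab invariantD[OF W(2) X(1)] by auto
        ultimately show ?thesis using W(4) by blast
      qed
      then have "{a, b} \<subseteq> {w. X *v w = 0}" by blast
      moreover have "subspace {w. X *v w = 0}"
        by (auto simp: subspace_def mv.zero_right mv.add_right mv.scaleR_right)
      ultimately have "W \<subseteq> {w. X *v w = 0}" unfolding ab(3) by (rule span_minimal)
      then have "X \<in> g1" using X(1) by (auto simp: g1_def)
      with g1_0 show "X = 0" by blast
    qed
    have "\<exists>X0. \<forall>Y\<in>g. \<exists>c. Y = c *\<^sub>R X0"
    proof (cases "\<exists>X0\<in>g. d X0 \<noteq> 0")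
      case True
      then obtain X0 where X0: "X0 \<in> g" "d X0 \<noteq> 0" by blast
      have "Y = (d Y / d X0) *\<^sub>R X0" if "Y \<in> g" for Y
      proof -
        have "Y - (d Y / d X0) *\<^sub>R X0 \<in> g" by (intro subspace_diff subspace_scale subspace_g that X0)
        moreover have "d (Y - (d Y / d X0) *\<^sub>R X0) = 0"
          using X0(2) by (simp add: d_def mv.diff_left mv.scaleR_left bf.diff_left bf.scaleR_left)
        ultimately show ?thesis using kill by fastforce
      qed
      then show ?thesis by blast
    next
      case False
      then have "Y = 0 *\<^sub>R 0" if "Y \<in> g" for Y using kill that by auto
      then show ?thesis by blast
    qed
    then obtain X0 where X0: "\<And>Y. Y \<in> g \<Longrightarrow> \<exists>c. Y = c *\<^sub>R X0" by blast
    have "orbit_tangent v \<subseteq> span {v, X0 *v v}"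
    proof
      fix x assume "x \<in> orbit_tangent v"
      then obtain Y where "Y \<in> g" "x = Y *v v" by (auto simp: orbit_tangent_def)
      then obtain c where "x = c *\<^sub>R (X0 *v v)" using X0 mv.scaleR_left by metis
      then show "x \<in> span {v, X0 *v v}" by (simp add: span_scale span_base)
    qed
    then have "span (insert v (orbit_tangent v)) \<subseteq> span {v, X0 *v v}"
      by (intro span_minimal) (auto intro: span_base)
    then have "dim (span (insert v (orbit_tangent v))) \<le> dim (span {v, X0 *v v})" by (rule dim_subset)
    also have "\<dots> \<le> card {v, X0 *v v}" by (simp add: dim_le_card')
    also have "\<dots> \<le> 2" by (simp add: card_insert_if)
    finally show False using orbit by simp
  qed
  obtain e1 e2 e3 where "E = span {e1, e2, e3}" "qform e1 \<noteq> 0" "qform e2 \<noteq> 0" "qform e3 \<noteq> 0"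
    "bform e1 e2 = 0" "bform e1 e3 = 0" "bform e2 e3 = 0"
    by (rule orthogonal_basis_3[OF Ep(1) Ed Ep(3)])
  then have frame: "orthogonal_frame E e1 e2 e3" by (simp add: orthogonal_frame_def)
  then interpret orthogonal_frame E e1 e2 e3 .
  define S where "S = axis ` g1"
  have S: "subspace S" "S \<subseteq> E"
    unfolding S_def using axis_in by (auto intro: linear_subspace_image linear_axis g1(1))
  have axis0: "X = 0" if X: "X \<in> g1" "axis X = 0" for X
  proof -
    have "W \<union> E \<subseteq> {x. X *v x = 0}"
      using g1(3)[OF X(1)] axis_eq_0[OF frame Ep(2) g1(2)[OF X(1)] X(2)] by blast
    moreover have "subspace {x. X *v x = 0}"
      by (auto simp: subspace_def mv.zero_right mv.add_right mv.scaleR_right)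
    ultimately have "span (W \<union> E) \<subseteq> {x. X *v x = 0}" by (rule span_minimal)
    then have "X *v x = 0 *v x" for x using sum by auto
    then show ?thesis using matrix_eq by blast
  qed
  have inj: "inj_on axis (span g1)"
  proof (rule inj_onI)
    fix X Y assume XY: "X \<in> span g1" "Y \<in> span g1" "axis X = axis Y"
    have "span g1 = g1" using g1(1) by (simp only: span_eq_iff)
    with XY have "X - Y \<in> g1" using subspace_diff[OF g1(1)] by simp
    moreover have "axis (X - Y) = 0" using XY(3) by (simp add: linear_diff[OF linear_axis])
    ultimately show "X = Y" using axis0 by fastforce
  qed
  have dS: "dim S = dim g1" unfolding S_def by (rule dim_image_eq[OF linear_axis inj])
  have Sinv: "invariant g S"
    unfolding invariant_def
  proof (intro ballI)
    fix Y x assume Y: "Y \<in> g" and "x \<in> S"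
    then obtain X where X: "X \<in> g1" "x = axis X" by (auto simp: S_def)
    then have "Y *v x = axis (Y ** X - X ** Y)" using axis_equivariant[OF frame Ep(2) Y g1(2)[OF X(1)]] by simp
    then show "Y *v x \<in> S" using ideal[OF Y X(1)] by (simp add: S_def)
  qed
  have "dim S \<noteq> 0"
  proof
    assume "dim S = 0"
    then have "g1 \<subseteq> {0}" using dS by simp
    then show False using \<open>g1 \<noteq> {0}\<close> subspace_0[OF g1(1)] by blast
  qed
  moreover have "dim S \<le> 3" using dim_subset[OF S(2)] Ep(3) by simp
  ultimately consider "dim S = 1" | "dim S = 2" | "dim S = 3" by linarith
  then show ?thesis
  proof cases
    case 1
    then show ?thesis by (rule invariant_line_of_dim_1[OF S(1) Sinv])
  next
    case 2
    have "W \<inter> S = {0}"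
    proof (rule antisym)
      show "W \<inter> S \<subseteq> {0}" using S(2) W(4) by (auto simp: E_def)
    qed (use subspace_0[OF S(1)] subspace_0[OF W(1)] in simp)
    then have "dim (span (W \<union> S)) = 4" using dim_add_direct[OF W(1) S(1)] W(3) 2 by simp
    moreover have "invariant g (span (W \<union> S))"
      by (rule invariant_span) (use invariantD[OF W(2)] invariantD[OF Sinv] in \<open>blast intro: span_base\<close>)
    ultimately show ?thesis by (intro invariant_line_of_dim_4[OF subspace_span])
  next
    case 3
    let ?K = "{X \<in> g1. X *v e = 0}"
    have lin: "linear (\<lambda>X :: real^5^5. X *v e)" by (rule bounded_linear.linear[OF mv.bounded_linear_left])
    have "dim ?K \<le> 1"
    proof -
      have "?K \<subseteq> g1" by blast
      then have "span ?K \<subseteq> span g1" by (rule span_mono)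
      then have "inj_on axis (span ?K)" by (rule inj_on_subset[OF inj])
      then have "dim ?K = dim (axis ` ?K)" by (rule dim_image_eq[OF linear_axis, symmetric])
      also have "\<dots> \<le> dim (span {e})"
        using axis_of_stabilizer[OF frame g1(2) ue(2) \<open>e \<noteq> 0\<close>] by (intro dim_subset) auto
      also have "\<dots> = 1" using \<open>e \<noteq> 0\<close> by (simp add: dim_singleton)
      finally show ?thesis .
    qed
    moreover have "dim ?K + dim ((\<lambda>X. X *v e) ` g1) = dim g1" by (rule dim_kernel_image[OF lin g1(1)])
    ultimately have "2 \<le> dim ((\<lambda>X. X *v e) ` g1)" using dS 3 by linarith
    moreover have "(\<lambda>X. X *v e) ` g1 \<subseteq> orbit_tangent v \<inter> E"
    proof
      fix x assume "x \<in> (\<lambda>X. X *v e) ` g1"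
      then obtain X where X: "X \<in> g1" "x = X *v e" by blast
      have "x \<in> E" unfolding X(2) by (rule invariantD[OF Ep(2) g1(2)[OF X(1)] ue(2)])
      moreover have "x = X *v v" using g1(3)[OF X(1) ue(1)] by (simp add: X(2) ue(3) mv.add_right)
      ultimately show "x \<in> orbit_tangent v \<inter> E" using g1(2)[OF X(1)] by (auto simp: orbit_tangent_def)
    qed
    moreover have "subspace ((\<lambda>X. X *v e) ` g1)" by (rule linear_subspace_image[OF lin g1(1)])
    ultimately show ?thesis
      by (intro invariant_line_of_transversal_orbit[OF Ep \<open>v \<notin> E\<close> orbit])
  qed
qed

section \<open>Fixed points in the projective space\<close>

text \<open>Passing from \<open>W\<close> to \<open>perp W\<close> exchanges the dimensions two and three.\<close>

lemma reducible_imp_invariant_line: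
  assumes W: "subspace W" "W \<noteq> {0}" "W \<noteq> UNIV" "invariant g W"
    and v: "v \<noteq> 0" "qform v = 0" and orbit: "dim (span (insert v (orbit_tangent v))) = 3"
  shows "has_invariant_line g"
proof -
  have plane: "has_invariant_line g" if P: "subspace P" "invariant g P" "dim P = 2" for P
  proof -
    let ?R = "P \<inter> perp P"
    have R: "subspace ?R" by (intro subspace_inter P subspace_perp)
    have "invariant g ?R" using P(2) invariant_perp[OF P(2)] by (auto simp: invariant_def)
    moreover have "dim ?R \<le> 2" using dim_subset[of ?R P] P(3) by simp
    then consider "dim ?R = 1" | "dim ?R = 2" | "dim ?R = 0" by linarith
    then show ?thesis
    proof cases
      case 1
      with R \<open>invariant g ?R\<close> show ?thesis by (intro invariant_line_of_dim_1)
    next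
      case 2
      then have "?R = P" using R P by (intro subspace_dim_equal) auto
      then show ?thesis using invariant_line_of_isotropic_plane[OF P _ v(2) orbit] by blast
    next
      case 3
      then have "?R = {0}" using subspace_0[OF R] by auto
      then show ?thesis by (rule invariant_line_of_nondegenerate_plane[OF P _ v orbit])
    qed
  qed
  have "dim W \<noteq> 0" using W(2) subspace_0[OF W(1)] by auto
  moreover have "dim W \<noteq> 5"
  proof
    assume "dim W = 5"
    then have "W = UNIV" using W(1) by (intro subspace_dim_equal) auto
    then show False using W(3) by simp
  qed
  moreover have "dim W \<le> 5" using dim_perp[OF W(1)] by simp
  ultimately consider "dim W = 1" | "dim W = 2" | "dim W = 3" | "dim W = 4" by linarith
  then show ?thesis
  proof cases
    case 1
    then show ?thesis by (rule invariant_line_of_dim_1[OF W(1,4)])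
  next
    case 2
    then show ?thesis by (rule plane[OF W(1,4)])
  next
    case 3
    then show ?thesis using plane[OF subspace_perp invariant_perp[OF W(4)]] dim_perp[OF W(1)] by simp
  next
    case 4
    then show ?thesis by (rule invariant_line_of_dim_4[OF W(1,4)])
  qed
qed

end

lemma O23_preserves_bform:
  assumes "A \<in> O23"
  shows "bform (A *v x) (A *v y) = bform x y"
proof -
  have q: "qform (A *v z) = qform z" for z using assms by (simp add: O23_def)
  show ?thesis
    using qform_add[of "A *v x" "A *v y"] qform_add[of x y] q[of "x + y"] q[of x] q[of y]
    by (simp add: mv.add_right)
qed

theorem theorem0p5:
  fixes G :: "(real^5^5) topology"
  assumes "lie_subgroup G"
    and "connected_space G"
    and "topspace G \<subseteq> SO23_id_component"
    and "acts_reducibly G"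
    and "cohomogeneity_one_on_Ein12 G"
  shows "\<exists>p\<in>projective_space. \<forall>A\<in>topspace G. (\<lambda>v. A *v v) ` p = p"
proof -
  interpret matrix_lie_group G by (unfold_locales) (fact assms(1))
  have O23: "topspace G \<subseteq> O23"
    using assms(3) connected_component_subset[of O23 "mat 1"] by (auto simp: SO23_id_component_def)
  interpret so23_subalgebra "lie_algebra G"
  proof
    fix X x y assume X: "X \<in> lie_algebra G"
    let ?b = "\<lambda>t. bform (matrix_exp (t *\<^sub>R X) *v x) (matrix_exp (t *\<^sub>R X) *v y)"
    have orbit: "((\<lambda>t. matrix_exp (t *\<^sub>R X) *v z) has_vector_derivative X *v z) (at 0)" for z
      using mv.has_vector_derivative[OF matrix_exp_has_vector_derivative[of X 0] has_vector_derivative_const[of z]]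
      by simp
    have "(?b has_vector_derivative (bform x (X *v y) + bform (X *v x) y)) (at 0)"
      using bf.has_vector_derivative[OF orbit orbit, of x y] by simp
    moreover have "matrix_exp (t *\<^sub>R X) \<in> O23" for t using lie_algebra_exp_in[OF X] O23 by blast
    then have "?b = (\<lambda>t. bform x y)" by (simp add: O23_preserves_bform)
    ultimately have "((\<lambda>t. bform x y) has_vector_derivative (bform x (X *v y) + bform (X *v x) y)) (at 0)"
      by simp
    from vector_derivative_unique_at[OF this has_vector_derivative_const]
    have "bform x (X *v y) + bform (X *v x) y = 0" .
    then show "bform (X *v x) y = - bform x (X *v y)" by simp
  qed (rule subspace_lie_algebra lie_algebra_bracket; assumption)+
  obtain W where W: "subspace W" "W \<noteq> {0}" "W \<noteq> UNIV" "\<And>A. A \<in> topspace G \<Longrightarrow> (\<lambda>v. A *v v) ` W = W"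
    using assms(4) by (auto simp: acts_reducibly_def)
  have "invariant (lie_algebra G) W"
    unfolding invariant_def using lie_algebra_preserves[OF _ W(1)] W(4) by blast
  obtain v where v: "v \<noteq> 0" "qform v = 0" and dim2: "orbit_dim G (span {v}) = 2"
    using assms(5) by (auto simp: cohomogeneity_one_on_Ein12_def Ein12_def)
  have "dim (span (insert v (orbit_tangent v))) = 3"
    using dim2 orbit_tangent_dim[OF v(1)] by (simp add: orbit_dim_def lie_algebra_stabilizer)
  then have "has_invariant_line (lie_algebra G)"
    by (rule reducible_imp_invariant_line[OF W(1-3) \<open>invariant (lie_algebra G) W\<close> v])
  then obtain l where l: "l \<noteq> 0" "invariant (lie_algebra G) (span {l})"
    by (auto simp: has_invariant_line_def)
  have "(\<lambda>w. A *v w) ` span {l} = span {l}" if "A \<in> topspace G" for A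
    using lie_algebra_invariant_imp_invariant[OF assms(2) subspace_span invariantD[OF l(2)] that] .
  then show ?thesis using l(1) by (auto simp: projective_space_def)
qed

end
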